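(* For any $A\in SPD(n)$ and any smooth vector fields $X,Y$ on $SPD(n)$, the Riemannian curvature tensor $R(X,Y,X,Y):=\langle R_{XY}X,Y\rangle_A$ of $(SPD(n),g_W)$ at $A$ has the explicit expression $$R(X,Y,X,Y)=3\,\mathrm{tr}\Big(\Gamma_A[X]\,A\,\Gamma_A\big[\Gamma_A[X]\Gamma_A[Y]-\Gamma_A[Y]\Gamma_A[X]\big]\,A\,\Gamma_A[Y]\Big).$$
   Context: $SPD(n)$ is the set of real symmetric positive-definite $n\times n$ matrices, an open subset of the space $Sym(n)$ of real symmetric matrices, so $T_ASPD(n)\cong Sym(n)$. For $A\in SPD(n)$ and a real $n\times n$ matrix $X$, $\Gamma_A[X]$ denotes the unique real matrix satisfying $A\,\Gamma_A[X]+\Gamma_A[X]\,A=X$. The Wasserstein metric is the Riemannian metric $\langle X,Y\rangle_A=g_W|_A(X,Y)=\mathrm{tr}(\Gamma_A[Y]\,A\,\Gamma_A[X])=\frac12\mathrm{tr}(\Gamma_A[Y]X)$ for $X,Y\in T_ASPD(n)$, and $\nabla$ is its Levi-Civita connection. Sign convention: $R_{XY}Z=\nabla_{[X,Y]}Z-\nabla_X\nabla_YZ+\nabla_Y\nabla_XZ$, so that the sectional curvature of the plane spanned by $X,Y$ is $R(X,Y,X,Y)/(\langle X,X\rangle\langle Y,Y\rangle-\langle X,Y\rangle^2)$. *)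

theory Defs
  imports "HOL-Analysis.Analysis"
begin

definition Sym :: "(real^'n^'n) set" where
  "Sym = {S. transpose S = S}"

definition SPD :: "(real^'n^'n) set" where
  "SPD = {A \<in> Sym. \<forall>x. x \<noteq> 0 \<longrightarrow> 0 < x \<bullet> (A *v x)}"

definition Lyap :: "real^'n^'n \<Rightarrow> real^'n^'n \<Rightarrow> real^'n^'n" where
  "Lyap A X = (THE K. A ** K + K ** A = X)"

definition wasserstein :: "real^'n^'n \<Rightarrow> real^'n^'n \<Rightarrow> real^'n^'n \<Rightarrow> real" where
  "wasserstein A X Y = trace (Lyap A Y ** A ** Lyap A X)"

text \<open>
  Tensor fields on the open subset SPD of the vector space Sym are represented by functions on
  all matrices; only their values on SPD are relevant.  SPD is not open in the space of all
  matrices, so a Frechet derivative within SPD is determined only in the directions tangent to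
  SPD, that is, on Sym.  It is applied to such directions only.
\<close>

definition dir_deriv ::
    "(real^'n^'n \<Rightarrow> 'b::real_normed_vector) \<Rightarrow> real^'n^'n \<Rightarrow> real^'n^'n \<Rightarrow> 'b" where
  "dir_deriv f A V = frechet_derivative f (at A within SPD) V"

text \<open>Membership in the class $C^k$ on the open subset SPD of Sym.\<close>

primrec C_class :: "nat \<Rightarrow> (real^'n^'n \<Rightarrow> 'b::real_normed_vector) \<Rightarrow> bool" where
  "C_class 0 f \<longleftrightarrow> continuous_on SPD f"
| "C_class (Suc k) f \<longleftrightarrow>
     f differentiable_on SPD \<and> (\<forall>V\<in>Sym. C_class k (\<lambda>A. dir_deriv f A V))"

definition smooth :: "(real^'n^'n \<Rightarrow> 'b::real_normed_vector) \<Rightarrow> bool" where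
  "smooth f \<longleftrightarrow> (\<forall>k. C_class k f)"

definition vector_field :: "(real^'n^'n \<Rightarrow> real^'n^'n) \<Rightarrow> bool" where
  "vector_field X \<longleftrightarrow> smooth X \<and> (\<forall>A\<in>SPD. X A \<in> Sym)"

text \<open>The bracket satisfies $[X,Y]f = X(Yf) - Y(Xf)$.\<close>

definition lie_bracket ::
    "(real^'n^'n \<Rightarrow> real^'n^'n) \<Rightarrow> (real^'n^'n \<Rightarrow> real^'n^'n) \<Rightarrow> real^'n^'n \<Rightarrow> real^'n^'n" where
  "lie_bracket X Y A = dir_deriv Y A (X A) - dir_deriv X A (Y A)"

definition affine_connection ::
    "((real^'n^'n \<Rightarrow> real^'n^'n) \<Rightarrow> (real^'n^'n \<Rightarrow> real^'n^'n) \<Rightarrow> real^'n^'n \<Rightarrow> real^'n^'n) \<Rightarrow> bool"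
  where
  "affine_connection nabla \<longleftrightarrow>
     (\<forall>X Y. vector_field X \<longrightarrow> vector_field Y \<longrightarrow> vector_field (nabla X Y)) \<and>
     (\<forall>X X' Y. vector_field X \<longrightarrow> vector_field X' \<longrightarrow> vector_field Y \<longrightarrow>
        (\<forall>A\<in>SPD. nabla (\<lambda>B. X B + X' B) Y A = nabla X Y A + nabla X' Y A)) \<and>
     (\<forall>(f :: real^'n^'n \<Rightarrow> real) X Y. smooth f \<longrightarrow> vector_field X \<longrightarrow> vector_field Y \<longrightarrow>
        (\<forall>A\<in>SPD. nabla (\<lambda>B. f B *\<^sub>R X B) Y A = f A *\<^sub>R nabla X Y A)) \<and>
     (\<forall>X Y Y'. vector_field X \<longrightarrow> vector_field Y \<longrightarrow> vector_field Y' \<longrightarrow>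
        (\<forall>A\<in>SPD. nabla X (\<lambda>B. Y B + Y' B) A = nabla X Y A + nabla X Y' A)) \<and>
     (\<forall>(f :: real^'n^'n \<Rightarrow> real) X Y. smooth f \<longrightarrow> vector_field X \<longrightarrow> vector_field Y \<longrightarrow>
        (\<forall>A\<in>SPD. nabla X (\<lambda>B. f B *\<^sub>R Y B) A =
           dir_deriv f A (X A) *\<^sub>R Y A + f A *\<^sub>R nabla X Y A))"

definition torsion_free ::
    "((real^'n^'n \<Rightarrow> real^'n^'n) \<Rightarrow> (real^'n^'n \<Rightarrow> real^'n^'n) \<Rightarrow> real^'n^'n \<Rightarrow> real^'n^'n) \<Rightarrow> bool"
  where
  "torsion_free nabla \<longleftrightarrow>
     (\<forall>X Y. vector_field X \<longrightarrow> vector_field Y \<longrightarrow>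
        (\<forall>A\<in>SPD. nabla X Y A - nabla Y X A = lie_bracket X Y A))"

definition metric_compatible ::
    "(real^'n^'n \<Rightarrow> real^'n^'n \<Rightarrow> real^'n^'n \<Rightarrow> real) \<Rightarrow>
     ((real^'n^'n \<Rightarrow> real^'n^'n) \<Rightarrow> (real^'n^'n \<Rightarrow> real^'n^'n) \<Rightarrow> real^'n^'n \<Rightarrow> real^'n^'n) \<Rightarrow> bool"
  where
  "metric_compatible g nabla \<longleftrightarrow>
     (\<forall>X Y Z. vector_field X \<longrightarrow> vector_field Y \<longrightarrow> vector_field Z \<longrightarrow>
        (\<forall>A\<in>SPD. dir_deriv (\<lambda>B. g B (Y B) (Z B)) A (X A) =
           g A (nabla X Y A) (Z A) + g A (Y A) (nabla X Z A)))"

definition levi_civita ::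
    "(real^'n^'n \<Rightarrow> real^'n^'n \<Rightarrow> real^'n^'n \<Rightarrow> real) \<Rightarrow>
     ((real^'n^'n \<Rightarrow> real^'n^'n) \<Rightarrow> (real^'n^'n \<Rightarrow> real^'n^'n) \<Rightarrow> real^'n^'n \<Rightarrow> real^'n^'n) \<Rightarrow> bool"
  where
  "levi_civita g nabla \<longleftrightarrow>
     affine_connection nabla \<and> torsion_free nabla \<and> metric_compatible g nabla"

text \<open>
  The sign convention is opposite to the common one, so that the sectional curvature is a positive
  multiple of $R(X,Y,X,Y)$.
\<close>

definition curvature ::
    "((real^'n^'n \<Rightarrow> real^'n^'n) \<Rightarrow> (real^'n^'n \<Rightarrow> real^'n^'n) \<Rightarrow> real^'n^'n \<Rightarrow> real^'n^'n) \<Rightarrow>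
     (real^'n^'n \<Rightarrow> real^'n^'n) \<Rightarrow> (real^'n^'n \<Rightarrow> real^'n^'n) \<Rightarrow> (real^'n^'n \<Rightarrow> real^'n^'n) \<Rightarrow>
     real^'n^'n \<Rightarrow> real^'n^'n"
  where
  "curvature nabla X Y Z A =
     nabla (lie_bracket X Y) Z A - nabla X (nabla Y Z) A + nabla Y (nabla X Z) A"

end

theory Submission
  imports Defs
begin

text \<open>
  Write \<open>x = Lyap A X\<close>, \<open>y = Lyap A Y\<close> and \<open>DY\<close> for the derivative of \<open>Y\<close>.  Differentiating the Lyapunov
  equation gives \<open>D\<^sub>V y = Lyap A (D\<^sub>V Y - V y - y V)\<close>, whence the connection
  \<open>D\<^sub>X Y - (x A y + y A x)\<close> is torsion-free and metric.  Its difference from the given Levi-Civita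
  connection, paired with a third field, is symmetric in the first two and antisymmetric in the last
  two arguments, so it vanishes.  In the curvature the second derivatives cancel by their symmetry,
  and what remains is a polynomial in \<open>A\<close>, \<open>x\<close>, \<open>y\<close> and \<open>Lyap A (x y - y x)\<close>, whose trace against \<open>y\<close> is
  evaluated by cyclic permutation and transposition of words.
\<close>

section \<open>Matrix products, traces and transposes\<close>

lemma bounded_bilinear_matrix_matrix_mult:
  "bounded_bilinear ((**) :: real^'n^'m \<Rightarrow> real^'p^'n \<Rightarrow> real^'p^'m)"
proof -
  have "bilinear ((**) :: real^'n^'m \<Rightarrow> real^'p^'n \<Rightarrow> real^'p^'m)"
    by (auto simp: bilinear_def matrix_add_ldistrib matrix_scalar_ac scalar_matrix_assoc
        vec_eq_iff matrix_matrix_mult_def algebra_simps sum.distrib sum_distrib_left intro!: linearI)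
  then show ?thesis
    by (simp add: bilinear_conv_bounded_bilinear)
qed

lemma bounded_bilinear_matrix_vector_mult:
  "bounded_bilinear ((*v) :: real^'n^'m \<Rightarrow> real^'n \<Rightarrow> real^'m)"
proof -
  have "bilinear ((*v) :: real^'n^'m \<Rightarrow> real^'n \<Rightarrow> real^'m)"
    by (auto simp: bilinear_def vec_eq_iff matrix_vector_mult_def algebra_simps sum.distrib
        sum_distrib_left intro!: linearI)
  then show ?thesis
    by (simp add: bilinear_conv_bounded_bilinear)
qed

interpretation mm: bounded_bilinear "(**) :: real^'n^'n \<Rightarrow> real^'n^'n \<Rightarrow> real^'n^'n"
  by (rule bounded_bilinear_matrix_matrix_mult)

lemmas matrix_expand = mm.add_left mm.add_right mm.diff_left mm.diff_right mm.minus_left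
  mm.minus_right mm.scaleR_left mm.scaleR_right matrix_mul_assoc [symmetric]

lemma trace_scaleR: "trace (c *\<^sub>R M) = c * trace M" for M :: "real^'n^'n"
  by (simp add: trace_def sum_distrib_left)

lemma trace_minus: "trace (- M) = - trace M" for M :: "real^'n^'n"
  by (simp add: trace_def sum_negf)

lemma bounded_linear_trace: "bounded_linear (trace :: real^'n^'n \<Rightarrow> real)"
  by (simp add: linear_conv_bounded_linear [symmetric] linearI trace_add trace_scaleR)

lemma trace_cyclic: "trace (P ** (Q ** S)) = trace (Q ** (S ** P))" for P Q S :: "real^'n^'n"
  by (metis matrix_mul_assoc trace_mul_sym)

lemma trace_transpose: "trace (transpose M) = trace M"
  by (simp add: trace_def transpose_def)

lemma transpose_add: "transpose (M + N) = transpose M + transpose N"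
  by (simp add: transpose_def vec_eq_iff)

lemma transpose_diff: "transpose (M - N) = transpose M - transpose N"
  by (simp add: transpose_def vec_eq_iff)

lemma transpose_minus: "transpose (- M) = - transpose M"
  by (simp add: transpose_def vec_eq_iff)

lemma bounded_linear_transpose: "bounded_linear (transpose :: real^'n^'n \<Rightarrow> real^'n^'n)"
  by (simp add: linear_conv_bounded_linear [symmetric] linearI transpose_add transpose_scalar)

section \<open>The space \<open>Sym\<close> and its open cone \<open>SPD\<close>\<close>

lemma subspace_Sym: "subspace Sym"
  by (auto simp: subspace_def Sym_def transpose_add transpose_scalar)
    (simp add: transpose_def vec_eq_iff)

lemma Sym_add: "S \<in> Sym \<Longrightarrow> T \<in> Sym \<Longrightarrow> S + T \<in> Sym"
  and Sym_diff: "S \<in> Sym \<Longrightarrow> T \<in> Sym \<Longrightarrow> S - T \<in> Sym"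
  and Sym_scaleR: "S \<in> Sym \<Longrightarrow> c *\<^sub>R S \<in> Sym"
  using subspace_Sym by (auto intro: subspace_add subspace_diff subspace_scale)

lemma SPD_Sym: "A \<in> SPD \<Longrightarrow> A \<in> Sym"
  by (simp add: SPD_def)

text \<open>By compactness the quadratic form of \<open>A\<close> has a positive minimum
  \<open>c\<close> on the unit sphere, hence by homogeneity dominates c |x|^2 everywhere. A
  perturbation of norm below \<open>c / K\<close>, with \<open>K\<close> the bound of the
  matrix-vector product, changes the form by less than that.\<close>

lemma SPD_open_in_Sym:
  fixes A :: "real^'n^'n"
  assumes "A \<in> SPD"
  obtains e where "e > 0" "\<And>S. S \<in> Sym \<Longrightarrow> norm (S - A) < e \<Longrightarrow> S \<in> SPD"
proof -
  interpret mv: bounded_bilinear "(*v) :: real^'n^'n \<Rightarrow> real^'n \<Rightarrow> real^'n"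
    by (rule bounded_bilinear_matrix_vector_mult)
  obtain K where K: "K > 0" "\<And>M x. norm ((M :: real^'n^'n) *v x) \<le> norm M * norm x * K"
    using mv.pos_bounded by blast
  let ?S = "sphere (0 :: real^'n) 1"
  have "continuous_on ?S (\<lambda>x. x \<bullet> (A *v x))"
    by (intro continuous_intros mv.continuous_on)
  moreover have "axis undefined 1 \<in> ?S" by simp
  ultimately obtain u where u: "u \<in> ?S" "\<And>x. x \<in> ?S \<Longrightarrow> u \<bullet> (A *v u) \<le> x \<bullet> (A *v x)"
    using continuous_attains_inf [of ?S "\<lambda>x. x \<bullet> (A *v x)"] by (metis compact_sphere empty_iff)
  define c where "c = u \<bullet> (A *v u)"
  have "u \<noteq> 0" using u(1) by auto
  then have c: "c > 0" using assms by (simp add: c_def SPD_def)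
  have lower: "c * (norm x)\<^sup>2 \<le> x \<bullet> (A *v x)" for x
  proof (cases "x = 0")
    case False
    then have "c \<le> (x /\<^sub>R norm x) \<bullet> (A *v (x /\<^sub>R norm x))"
      unfolding c_def by (intro u(2)) simp
    also have "\<dots> = (x \<bullet> (A *v x)) / (norm x)\<^sup>2"
      by (simp add: mv.scaleR_right power2_eq_square field_simps)
    finally show ?thesis using False by (simp add: field_simps)
  qed simp
  show thesis
  proof (rule that [of "c / K"])
    show "c / K > 0" using c K(1) by simp
    fix S :: "real^'n^'n" assume S: "S \<in> Sym" "norm (S - A) < c / K"
    have "0 < x \<bullet> (S *v x)" if "x \<noteq> 0" for x
    proof -
      have "\<bar>x \<bullet> ((S - A) *v x)\<bar> \<le> norm x * (norm (S - A) * norm x * K)"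
        by (meson Cauchy_Schwarz_ineq2 K(2) mult_left_mono norm_ge_zero order_trans)
      also have "\<dots> = (norm (S - A) * K) * (norm x)\<^sup>2"
        by (simp add: power2_eq_square)
      also have "\<dots> < c * (norm x)\<^sup>2"
        using S(2) K(1) that by (intro mult_strict_right_mono) (simp_all add: field_simps)
      finally have "\<bar>x \<bullet> ((S - A) *v x)\<bar> < x \<bullet> (A *v x)"
        using lower [of x] by linarith
      then show ?thesis by (simp add: mv.diff_left inner_diff_right)
    qed
    then show "S \<in> SPD" using S(1) by (simp add: SPD_def)
  qed
qed

section \<open>The Lyapunov equation\<close>

lemma trace_congruence:
  fixes A :: "real^'n^'n"
  shows "trace (transpose K ** (A ** K)) = (\<Sum>i\<in>UNIV. column i K \<bullet> (A *v column i K))"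
  by (simp add: trace_def matrix_matrix_mult_def transpose_def column_def inner_vec_def
      matrix_vector_mult_def)

lemma trace_congruence_nonneg:
  fixes A :: "real^'n^'n"
  assumes "A \<in> SPD"
  shows "0 \<le> trace (transpose K ** (A ** K))"
proof -
  have "0 \<le> x \<bullet> (A *v x)" for x
    using assms by (cases "x = 0") (auto simp: SPD_def less_imp_le)
  then show ?thesis
    by (simp add: trace_congruence sum_nonneg)
qed

lemma trace_congruence_eq_0:
  fixes A :: "real^'n^'n"
  assumes A: "A \<in> SPD" and K: "trace (transpose K ** (A ** K)) = 0"
  shows "K = 0"
proof -
  have nonneg: "0 \<le> x \<bullet> (A *v x)" for x
    using A by (cases "x = 0") (auto simp: SPD_def less_imp_le)
  have "column i K \<bullet> (A *v column i K) = 0" for i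
    using K by (simp add: trace_congruence sum_nonneg_eq_0_iff nonneg)
  then have "column i K = 0" for i
    using A unfolding SPD_def by (metis (mono_tags, lifting) less_irrefl mem_Collect_eq)
  then show ?thesis
    by (simp add: column_def vec_eq_iff)
qed

text \<open>Multiplying the equation by \<open>transpose K\<close> and taking the trace gives a sum
  of two nonnegative congruence traces, one for \<open>K\<close> and one for
  \<open>transpose K\<close>; both must vanish. \<open>K\<close> is an arbitrary matrix here because
  the description in \<open>Lyap\<close> ranges over all matrices.\<close>

lemma lyapunov_injective:
  fixes A :: "real^'n^'n"
  assumes A: "A \<in> SPD" and K: "A ** K + K ** A = 0"
  shows "K = 0"
proof -
  have "trace (transpose K ** (A ** K)) + trace (transpose (transpose K) ** (A ** transpose K))
      = trace (transpose K ** (A ** K + K ** A))"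
    by (simp add: matrix_add_ldistrib trace_add trace_cyclic [of K A "transpose K"]
        trace_cyclic [of A "transpose K" K])
  also have "\<dots> = 0" by (simp add: K trace_def)
  finally have "trace (transpose K ** (A ** K)) = 0"
    using trace_congruence_nonneg [OF A, of K] trace_congruence_nonneg [OF A, of "transpose K"]
    by linarith
  then show ?thesis
    by (rule trace_congruence_eq_0 [OF A])
qed

text \<open>An injective endomorphism of a finite-dimensional space is bijective, so the definite
  description in \<open>Lyap\<close> denotes.\<close>

lemma lyapunov_solution:
  fixes A :: "real^'n^'n"
  assumes A: "A \<in> SPD"
  shows "A ** Lyap A X + Lyap A X ** A = X"
proof -
  let ?M = "\<lambda>K. A ** K + K ** A"
  have lin: "linear ?M"
    by (intro linearI) (simp_all add: matrix_expand scaleR_right_distrib)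
  have "inj ?M"
    unfolding linear_injective_0 [OF lin] by (blast intro: lyapunov_injective [OF A])
  have "surj ?M"
    by (rule linear_inj_imp_surj [OF lin \<open>inj ?M\<close>])
  then obtain K where K: "X = ?M K" using surjD [of ?M X] by auto
  have "\<exists>!K. ?M K = X"
  proof (rule ex1I)
    show "?M K = X" by (rule K [symmetric])
    show "K' = K" if "?M K' = X" for K'
      using \<open>inj ?M\<close> by (rule injD) (simp add: that K)
  qed
  then show ?thesis
    unfolding Lyap_def by (rule theI')
qed

text \<open>The standard way to compute a value of \<open>Lyap\<close>: guess it and check the
  equation.\<close>

lemma Lyap_eqI:
  fixes A :: "real^'n^'n"
  assumes "A \<in> SPD" and "A ** K + K ** A = X"
  shows "Lyap A X = K"
proof -
  have "A ** (Lyap A X - K) + (Lyap A X - K) ** A = 0"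
    using lyapunov_solution [OF assms(1), of X] assms(2) by (simp add: matrix_expand algebra_simps)
  then show ?thesis
    using lyapunov_injective [OF assms(1), of "Lyap A X - K"] by simp
qed

lemma linear_Lyap:
  assumes "A \<in> SPD"
  shows "linear (Lyap A)"
proof (rule linearI)
  show "Lyap A (X + Y) = Lyap A X + Lyap A Y" for X Y
    using lyapunov_solution [OF assms, of X] lyapunov_solution [OF assms, of Y]
    by (intro Lyap_eqI [OF assms]) (simp add: matrix_expand algebra_simps)
  show "Lyap A (c *\<^sub>R X) = c *\<^sub>R Lyap A X" for c X
    using lyapunov_solution [OF assms, of X]
    by (intro Lyap_eqI [OF assms]) (simp add: matrix_expand flip: scaleR_right_distrib)
qed

lemma transpose_Lyap:
  assumes "A \<in> SPD"
  shows "transpose (Lyap A X) = Lyap A (transpose X)"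
proof -
  have "transpose A = A" using assms by (simp add: SPD_def Sym_def)
  moreover have "transpose (A ** Lyap A X + Lyap A X ** A) = transpose X"
    by (simp add: lyapunov_solution [OF assms])
  ultimately have "A ** transpose (Lyap A X) + transpose (Lyap A X) ** A = transpose X"
    by (metis transpose_add matrix_transpose_mul add.commute)
  then show ?thesis
    by (rule Lyap_eqI [OF assms, symmetric])
qed

lemma Lyap_Sym: "A \<in> SPD \<Longrightarrow> X \<in> Sym \<Longrightarrow> Lyap A X \<in> Sym"
  by (simp add: Sym_def transpose_Lyap)

text \<open>\<open>Lyap A\<close> inverts the map sending K to AK + KA, which is self-adjoint for
  the pairing tr(XY) by cyclicity; so \<open>Lyap A\<close> is self-adjoint too.\<close>

lemma trace_Lyap_left:
  fixes A :: "real^'n^'n"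
  assumes "A \<in> SPD"
  shows "trace (Lyap A X ** Y) = trace (X ** Lyap A Y)"
proof -
  let ?x = "Lyap A X" and ?y = "Lyap A Y"
  have "trace (?x ** (A ** ?y + ?y ** A)) = trace ((A ** ?x + ?x ** A) ** ?y)"
    by (simp add: matrix_expand trace_add trace_cyclic [of A ?x ?y])
  then show ?thesis by (simp add: lyapunov_solution [OF assms])
qed

text \<open>Substituting X = Ax + xA splits the trace into two words. Each equals tr(yAx), the first
  by cyclicity and the second by transposition, where symmetry enters. This form contains a single
  \<open>Lyap\<close> and is therefore easier to differentiate.\<close>

lemma wasserstein_trace:
  fixes A :: "real^'n^'n"
  assumes A: "A \<in> SPD" and X: "X \<in> Sym" and Y: "Y \<in> Sym"
  shows "wasserstein A X Y = trace (X ** Lyap A Y) / 2"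
proof -
  let ?x = "Lyap A X" and ?y = "Lyap A Y"
  have s: "transpose A = A" "transpose ?x = ?x" "transpose ?y = ?y"
    using A Lyap_Sym [OF A] X Y by (auto simp: Sym_def SPD_def)
  have "trace (X ** ?y) = trace (A ** (?x ** ?y)) + trace (?x ** (A ** ?y))"
    by (subst lyapunov_solution [OF A, of X, symmetric]) (simp add: matrix_expand trace_add)
  moreover have "trace (A ** (?x ** ?y)) = trace (?y ** (A ** ?x))"
    by (metis trace_cyclic)
  moreover have "trace (?x ** (A ** ?y)) = trace (transpose (?x ** (A ** ?y)))"
    by (rule trace_transpose [symmetric])
  moreover have "\<dots> = trace (?y ** (A ** ?x))"
    by (simp add: matrix_transpose_mul s matrix_mul_assoc)
  ultimately show ?thesis by (simp add: wasserstein_def matrix_mul_assoc)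
qed

section \<open>Differentiation within SPD\<close>

text \<open>Openness of \<open>SPD\<close> in \<open>Sym\<close> keeps the line inside
  \<open>SPD\<close> for all parameters near \<open>t\<close>, which turns a derivative within
  \<open>SPD\<close> into an unrestricted derivative on the real line.\<close>

lemma has_derivative_along_line:
  fixes f :: "real^'n^'n \<Rightarrow> 'b::real_normed_vector"
  assumes "B + t *\<^sub>R V \<in> SPD" and V: "V \<in> Sym"
    and f: "(f has_derivative f') (at (B + t *\<^sub>R V) within SPD)"
  shows "((\<lambda>s. f (B + s *\<^sub>R V)) has_derivative (\<lambda>s. f' (s *\<^sub>R V))) (at t)"
proof -
  obtain e where e: "e > 0"
    "\<And>S. S \<in> Sym \<Longrightarrow> norm (S - (B + t *\<^sub>R V)) < e \<Longrightarrow> S \<in> SPD"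
    using SPD_open_in_Sym [OF assms(1)] by blast
  define T where "T = {s. norm ((B + s *\<^sub>R V) - (B + t *\<^sub>R V)) < e}"
  have "open T"
    unfolding T_def by (intro open_Collect_less continuous_intros)
  have "t \<in> T" using e(1) by (simp add: T_def)
  have "B + s *\<^sub>R V \<in> Sym" for s
    using Sym_add [OF SPD_Sym [OF assms(1)] Sym_scaleR [OF V, of "s - t"]]
    by (simp add: algebra_simps)
  then have "(\<lambda>s. B + s *\<^sub>R V) ` T \<subseteq> SPD"
    using e(2) by (auto simp: T_def)
  then have "(f has_derivative f') (at (B + t *\<^sub>R V) within (\<lambda>s. B + s *\<^sub>R V) ` T)"
    using f has_derivative_subset by blast
  note f' = this
  have g: "((\<lambda>s. B + s *\<^sub>R V) has_derivative (\<lambda>s. s *\<^sub>R V)) (at t within T)"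
    using has_derivative_add [OF has_derivative_const has_derivative_scaleR_left [OF has_derivative_ident]]
    by simp
  have "((\<lambda>s. f (B + s *\<^sub>R V)) has_derivative (\<lambda>s. f' (s *\<^sub>R V))) (at t within T)"
    by (rule has_derivative_in_compose [OF g f'])
  then show ?thesis
    unfolding at_within_open [OF \<open>t \<in> T\<close> \<open>open T\<close>] .
qed

text \<open>\<open>SPD\<close> has empty interior among all matrices in general, so uniqueness is
  reduced to that of derivatives on the real line, one symmetric direction at a time.\<close>

lemma has_derivative_SPD_unique:
  fixes f :: "real^'n^'n \<Rightarrow> 'b::real_normed_vector"
  assumes "A \<in> SPD" and "V \<in> Sym"
    and "(f has_derivative f') (at A within SPD)" and "(f has_derivative f'') (at A within SPD)"
  shows "f' V = f'' V"
proof -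
  have "((\<lambda>s. f (A + s *\<^sub>R V)) has_derivative (\<lambda>s. f' (s *\<^sub>R V))) (at 0)"
    "((\<lambda>s. f (A + s *\<^sub>R V)) has_derivative (\<lambda>s. f'' (s *\<^sub>R V))) (at 0)"
    by (rule has_derivative_along_line; simp add: assms)+
  then have "(\<lambda>s. f' (s *\<^sub>R V)) = (\<lambda>s. f'' (s *\<^sub>R V))"
    by (rule has_derivative_unique)
  then have "f' (1 *\<^sub>R V) = f'' (1 *\<^sub>R V)" by (rule fun_cong)
  then show ?thesis by simp
qed

lemma has_derivative_dir_deriv:
  "f differentiable (at A within SPD) \<Longrightarrow> (f has_derivative dir_deriv f A) (at A within SPD)"
  unfolding dir_deriv_def by (simp add: frechet_derivative_works [symmetric])

lemma dir_deriv_eq: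
  fixes f :: "real^'n^'n \<Rightarrow> 'b::real_normed_vector"
  assumes "A \<in> SPD" and "V \<in> Sym" and "(f has_derivative f') (at A within SPD)"
  shows "dir_deriv f A V = f' V"
proof -
  have "f differentiable (at A within SPD)"
    using assms(3) by (auto simp: differentiable_def)
  from has_derivative_SPD_unique [OF assms(1,2) has_derivative_dir_deriv [OF this] assms(3)]
  show ?thesis .
qed

lemma has_derivative_SPD_cong:
  assumes "A \<in> SPD" and "\<And>B. B \<in> SPD \<Longrightarrow> f B = g B"
  shows "(f has_derivative f') (at A within SPD) \<longleftrightarrow> (g has_derivative f') (at A within SPD)"
  by (rule iffI; erule has_derivative_transform [OF assms(1), rotated]; simp add: assms(2))

text \<open>This holds even for \<open>V\<close> outside \<open>Sym\<close>: both functions have the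
  same set of derivatives at \<open>A\<close>, so the choice operator in
  \<open>frechet_derivative\<close> picks the same one.\<close>

lemma dir_deriv_cong:
  assumes "A \<in> SPD" and "\<And>B. B \<in> SPD \<Longrightarrow> f B = g B"
  shows "dir_deriv f A V = dir_deriv g A V"
  unfolding dir_deriv_def frechet_derivative_def
  using has_derivative_SPD_cong [of A f g] assms by simp

lemma differentiable_on_SPD_cong:
  assumes "\<And>B. B \<in> SPD \<Longrightarrow> f B = g B"
  shows "f differentiable_on SPD \<longleftrightarrow> g differentiable_on SPD"
  unfolding differentiable_on_def differentiable_def
  using has_derivative_SPD_cong [of _ f g] assms by blast

lemma dir_deriv_linear_compose:
  assumes "A \<in> SPD" "V \<in> Sym" "bounded_linear h" "f differentiable (at A within SPD)"
  shows "dir_deriv (\<lambda>B. h (f B)) A V = h (dir_deriv f A V)"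
  by (rule dir_deriv_eq [OF assms(1,2)])
    (rule bounded_linear.has_derivative [OF assms(3) has_derivative_dir_deriv [OF assms(4)]])

lemma dir_deriv_add:
  assumes "A \<in> SPD" "V \<in> Sym" "f differentiable (at A within SPD)" "g differentiable (at A within SPD)"
  shows "dir_deriv (\<lambda>B. f B + g B) A V = dir_deriv f A V + dir_deriv g A V"
  by (rule dir_deriv_eq [OF assms(1,2)])
    (intro has_derivative_add has_derivative_dir_deriv assms)

text \<open>Differentiation rules identify \<open>dir_deriv\<close> with the expected expression on
  \<open>SPD\<close> only; this lemma lets the inductions on \<open>C_class\<close> replace one by
  the other.\<close>

lemma C_class_cong:
  assumes "\<And>B. B \<in> SPD \<Longrightarrow> f B = g B"
  shows "C_class k f \<longleftrightarrow> C_class k g"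
  using assms
proof (induction k arbitrary: f g)
  case 0
  then show ?case by (simp cong: continuous_on_cong)
next
  case (Suc k)
  have "C_class k (\<lambda>A. dir_deriv f A V) \<longleftrightarrow> C_class k (\<lambda>A. dir_deriv g A V)" for V
    by (rule Suc.IH) (rule dir_deriv_cong, simp_all add: Suc.prems)
  then show ?case
    using differentiable_on_SPD_cong [of f g] Suc.prems by simp
qed

lemma C_class_linear_compose:
  assumes "bounded_linear h" and "C_class k f"
  shows "C_class k (\<lambda>B. h (f B))"
  using assms(2)
proof (induction k arbitrary: f)
  case 0
  then show ?case by (simp add: bounded_linear.continuous_on [OF assms(1)])
next
  case (Suc k)
  have "C_class k (\<lambda>A. dir_deriv (\<lambda>B. h (f B)) A V)" if "V \<in> Sym" for V
  proof -
    have "C_class k (\<lambda>A. h (dir_deriv f A V))"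
      using Suc that by simp
    then show ?thesis
      by (rule C_class_cong [THEN iffD1, rotated], intro dir_deriv_linear_compose [symmetric])
        (use Suc.prems assms(1) that in \<open>auto simp: differentiable_on_def\<close>)
  qed
  moreover have "(\<lambda>B. h (f B)) differentiable_on SPD"
    using Suc.prems differentiable_compose [OF bounded_linear_imp_differentiable [OF assms(1)], of f]
    by (simp add: differentiable_on_def)
  ultimately show ?case by simp
qed

lemma C_class_add:
  assumes "C_class k f" and "C_class k g"
  shows "C_class k (\<lambda>B. f B + g B)"
  using assms
proof (induction k arbitrary: f g)
  case 0
  then show ?case by (simp add: continuous_on_add)
next
  case (Suc k)
  have "C_class k (\<lambda>A. dir_deriv (\<lambda>B. f B + g B) A V)" if "V \<in> Sym" for V
  proof -
    have "C_class k (\<lambda>A. dir_deriv f A V + dir_deriv g A V)"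
      using Suc that by simp
    then show ?thesis
      by (rule C_class_cong [THEN iffD1, rotated], intro dir_deriv_add [symmetric])
        (use Suc.prems that in \<open>auto simp: differentiable_on_def\<close>)
  qed
  moreover have "(\<lambda>B. f B + g B) differentiable_on SPD"
    using Suc.prems by (simp add: differentiable_on_add)
  ultimately show ?case by simp
qed

lemma C_class_const:
  fixes c :: "'b::real_normed_vector"
  shows "C_class k (\<lambda>B :: real^'n^'n. c)"
proof (induction k arbitrary: c)
  case (Suc k)
  have "C_class k (\<lambda>A. dir_deriv (\<lambda>B. c) A V)" if "V \<in> Sym" for V :: "real^'n^'n"
  proof (rule C_class_cong [THEN iffD1])
    show "0 = dir_deriv (\<lambda>B. c) A V" if "A \<in> SPD" for A :: "real^'n^'n"
      using \<open>A \<in> SPD\<close> \<open>V \<in> Sym\<close> has_derivative_const by (rule dir_deriv_eq [symmetric])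
    show "C_class k (\<lambda>A :: real^'n^'n. 0 :: 'b)" by (rule Suc.IH)
  qed
  then show ?case by simp
qed simp

section \<open>Vector fields and their first derivatives\<close>

lemma vector_field_cong:
  assumes "\<And>B. B \<in> SPD \<Longrightarrow> X B = Y B"
  shows "vector_field X \<longleftrightarrow> vector_field Y"
  using assms C_class_cong [of X Y] by (auto simp: vector_field_def smooth_def)

lemma vector_field_const: "W \<in> Sym \<Longrightarrow> vector_field (\<lambda>B. W)"
  by (simp add: vector_field_def smooth_def C_class_const)

lemma vector_field_diff:
  assumes "vector_field X" and "vector_field Y"
  shows "vector_field (\<lambda>B. X B - Y B)"
proof -
  have "C_class k (\<lambda>B. X B + - Y B)" for k
    using assms
    by (intro C_class_add C_class_linear_compose [OF bounded_linear_minus [OF bounded_linear_ident]])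
      (simp_all add: vector_field_def smooth_def)
  then show ?thesis
    using assms by (simp add: vector_field_def smooth_def Sym_diff)
qed

lemma vector_field_Sym: "vector_field X \<Longrightarrow> A \<in> SPD \<Longrightarrow> X A \<in> Sym"
  by (simp add: vector_field_def)

lemma vector_field_differentiable:
  "vector_field X \<Longrightarrow> A \<in> SPD \<Longrightarrow> X differentiable (at A within SPD)"
  unfolding vector_field_def smooth_def differentiable_on_def [symmetric]
  by (metis C_class.simps(2) differentiable_on_def)

lemma vector_field_has_derivative:
  "vector_field X \<Longrightarrow> A \<in> SPD \<Longrightarrow> (X has_derivative dir_deriv X A) (at A within SPD)"
  by (intro has_derivative_dir_deriv vector_field_differentiable)

lemma dir_deriv_Sym:
  assumes X: "vector_field X" and A: "A \<in> SPD" and V: "V \<in> Sym"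
  shows "dir_deriv X A V \<in> Sym"
proof -
  have "transpose (dir_deriv X A V) = dir_deriv (\<lambda>B. transpose (X B)) A V"
    using A V bounded_linear_transpose vector_field_differentiable [OF X A]
    by (rule dir_deriv_linear_compose [symmetric])
  also have "\<dots> = dir_deriv X A V"
    using vector_field_Sym [OF X] by (intro dir_deriv_cong A) (simp add: Sym_def)
  finally show ?thesis by (simp add: Sym_def)
qed

section \<open>Second derivatives\<close>

text \<open>The mean value theorem is applied twice: in \<open>s\<close> to the difference of
  \<open>f\<close> at heights \<open>h\<close> and 0 along \<open>V\<close>, then in
  \<open>t\<close> to the derivative in direction \<open>U\<close>.\<close>

lemma second_difference_mean_value:
  fixes f :: "real^'n^'n \<Rightarrow> real"
  assumes f: "C_class 2 f" and U: "U \<in> Sym" and V: "V \<in> Sym" and "h > 0"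
    and P: "\<And>s t. \<bar>s\<bar> \<le> h \<Longrightarrow> \<bar>t\<bar> \<le> h \<Longrightarrow> A + s *\<^sub>R U + t *\<^sub>R V \<in> SPD"
  obtains s t where "0 < s" "s < h" "0 < t" "t < h"
    "f (A + h *\<^sub>R U + h *\<^sub>R V) - f (A + h *\<^sub>R U) - f (A + h *\<^sub>R V) + f A
      = h * h * dir_deriv (\<lambda>B. dir_deriv f B U) (A + s *\<^sub>R U + t *\<^sub>R V) V"
proof -
  have f1: "f differentiable_on SPD" and f2: "(\<lambda>B. dir_deriv f B U) differentiable_on SPD"
    using f U by (simp_all add: numeral_2_eq_2)
  have lin: "linear (dir_deriv g B)" if "g differentiable_on SPD" "B \<in> SPD" for g :: "real^'n^'n \<Rightarrow> real" and B
    using has_derivative_dir_deriv that has_derivative_linear by (metis differentiable_on_def)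
  have dU: "((\<lambda>s. f (A + s *\<^sub>R U + t *\<^sub>R V)) has_real_derivative
      dir_deriv f (A + s *\<^sub>R U + t *\<^sub>R V) U) (at s)" if "\<bar>s\<bar> \<le> h" "\<bar>t\<bar> \<le> h" for s t
  proof -
    have eq: "A + s *\<^sub>R U + t *\<^sub>R V = (A + t *\<^sub>R V) + s *\<^sub>R U" for s by simp
    have S: "(A + t *\<^sub>R V) + s *\<^sub>R U \<in> SPD" using P [OF that] by (simp add: algebra_simps)
    have "((\<lambda>s. f ((A + t *\<^sub>R V) + s *\<^sub>R U)) has_derivative
        (\<lambda>r. dir_deriv f ((A + t *\<^sub>R V) + s *\<^sub>R U) (r *\<^sub>R U))) (at s)"
      using f1 S by (intro has_derivative_along_line has_derivative_dir_deriv U S)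
        (simp add: differentiable_on_def)
    then show ?thesis
      unfolding eq has_field_derivative_def
      using linear_scale [OF lin [OF f1 S]] by (simp add: mult_commute_abs)
  qed
  have dV: "((\<lambda>t. dir_deriv f (A + s *\<^sub>R U + t *\<^sub>R V) U) has_real_derivative
      dir_deriv (\<lambda>B. dir_deriv f B U) (A + s *\<^sub>R U + t *\<^sub>R V) V) (at t)" if "\<bar>s\<bar> \<le> h" "\<bar>t\<bar> \<le> h" for s t
  proof -
    note S = P [OF that]
    have "((\<lambda>t. dir_deriv f (A + s *\<^sub>R U + t *\<^sub>R V) U) has_derivative
        (\<lambda>r. dir_deriv (\<lambda>B. dir_deriv f B U) (A + s *\<^sub>R U + t *\<^sub>R V) (r *\<^sub>R V))) (at t)"
      using f2 S by (intro has_derivative_along_line [where f = "\<lambda>B. dir_deriv f B U"] 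
          has_derivative_dir_deriv V S) (simp add: differentiable_on_def)
    then show ?thesis
      unfolding has_field_derivative_def
      using linear_scale [OF lin [OF f2 S]] by (simp add: mult_commute_abs)
  qed
  \<comment> \<open>The terms with coefficient 0 are kept so that all points have the shape required
    by \<open>dU\<close>.\<close>
  have "\<exists>s>0. s < h \<and> (f (A + h *\<^sub>R U + h *\<^sub>R V) - f (A + h *\<^sub>R U + 0 *\<^sub>R V))
      - (f (A + 0 *\<^sub>R U + h *\<^sub>R V) - f (A + 0 *\<^sub>R U + 0 *\<^sub>R V))
      = (h - 0) * (dir_deriv f (A + s *\<^sub>R U + h *\<^sub>R V) U - dir_deriv f (A + s *\<^sub>R U + 0 *\<^sub>R V) U)"
    by (intro MVT2 \<open>h > 0\<close> DERIV_diff dU) (use \<open>h > 0\<close> in auto)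
  then obtain s where s: "0 < s" "s < h"
    "f (A + h *\<^sub>R U + h *\<^sub>R V) - f (A + h *\<^sub>R U) - f (A + h *\<^sub>R V) + f A
      = h * (dir_deriv f (A + s *\<^sub>R U + h *\<^sub>R V) U - dir_deriv f (A + s *\<^sub>R U + 0 *\<^sub>R V) U)"
    by auto
  have "\<exists>t>0. t < h \<and> dir_deriv f (A + s *\<^sub>R U + h *\<^sub>R V) U - dir_deriv f (A + s *\<^sub>R U + 0 *\<^sub>R V) U
      = (h - 0) * dir_deriv (\<lambda>B. dir_deriv f B U) (A + s *\<^sub>R U + t *\<^sub>R V) V"
    by (intro MVT2 \<open>h > 0\<close> dV) (use s in auto)
  then show thesis
    using that s by auto
qed

text \<open>One second difference equals h^2 times each of the two mixed derivatives, taken at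
  points close to \<open>A\<close>. Continuity of both mixed derivatives, which
  \<open>C_class 2\<close> includes, makes their values at \<open>A\<close> differ arbitrarily
  little.\<close>

lemma second_derivative_symmetric_real:
  fixes f :: "real^'n^'n \<Rightarrow> real"
  assumes f: "C_class 2 f" and A: "A \<in> SPD" and U: "U \<in> Sym" and V: "V \<in> Sym"
  shows "dir_deriv (\<lambda>B. dir_deriv f B U) A V = dir_deriv (\<lambda>B. dir_deriv f B V) A U"
proof -
  let ?a = "\<lambda>B. dir_deriv (\<lambda>B. dir_deriv f B U) B V"
  let ?b = "\<lambda>B. dir_deriv (\<lambda>B. dir_deriv f B V) B U"
  have "\<bar>?a A - ?b A\<bar> < 2 * \<epsilon>" if "\<epsilon> > 0" for \<epsilon>
  proof -
    have a: "continuous_on SPD ?a" and b: "continuous_on SPD ?b"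
      using f U V by (simp_all add: numeral_2_eq_2)
    obtain d1 where d1: "d1 > 0" "\<And>B. B \<in> SPD \<Longrightarrow> norm (B - A) < d1 \<Longrightarrow> \<bar>?a B - ?a A\<bar> < \<epsilon>"
      using a [unfolded continuous_on_iff dist_norm real_norm_def, rule_format, OF A \<open>\<epsilon> > 0\<close>] by blast
    obtain d2 where d2: "d2 > 0" "\<And>B. B \<in> SPD \<Longrightarrow> norm (B - A) < d2 \<Longrightarrow> \<bar>?b B - ?b A\<bar> < \<epsilon>"
      using b [unfolded continuous_on_iff dist_norm real_norm_def, rule_format, OF A \<open>\<epsilon> > 0\<close>] by blast
    obtain e where e: "e > 0" "\<And>S. S \<in> Sym \<Longrightarrow> norm (S - A) < e \<Longrightarrow> S \<in> SPD"
      using SPD_open_in_Sym [OF A] by blast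
    define r where "r = min e (min d1 d2)"
    \<comment> \<open>With this \<open>h\<close> the whole parallelogram of parameters of size at
      most \<open>h\<close> stays within \<open>r\<close> of \<open>A\<close>; the added 1 makes the
      denominator positive and the estimate strict.\<close>
    define h where "h = r / (norm U + norm V + 1)"
    have r: "r > 0" using d1 d2 e by (simp add: r_def)
    have den: "norm U + norm V + 1 > 0" by (simp add: add_nonneg_pos)
    have h: "h > 0" using r den by (simp add: h_def)
    have near: "norm (A + s *\<^sub>R U + t *\<^sub>R V - A) < r" if "\<bar>s\<bar> \<le> h" "\<bar>t\<bar> \<le> h" for s t
    proof -
      have "norm (A + s *\<^sub>R U + t *\<^sub>R V - A) \<le> \<bar>s\<bar> * norm U + \<bar>t\<bar> * norm V"
        using norm_triangle_ineq [of "s *\<^sub>R U" "t *\<^sub>R V"] by (simp add: algebra_simps)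
      also have "\<dots> \<le> h * norm U + h * norm V"
        using that by (intro add_mono mult_right_mono) auto
      also have "\<dots> < h * (norm U + norm V + 1)"
        using h by (simp add: algebra_simps)
      also have "\<dots> = r" using den by (simp add: h_def)
      finally show ?thesis .
    qed
    have P: "A + s *\<^sub>R U + t *\<^sub>R V \<in> SPD" if "\<bar>s\<bar> \<le> h" "\<bar>t\<bar> \<le> h" for s t
      using near [OF that] U V SPD_Sym [OF A] by (intro e Sym_add Sym_scaleR) (simp_all add: r_def)
    have P': "A + s *\<^sub>R V + t *\<^sub>R U \<in> SPD" if "\<bar>s\<bar> \<le> h" "\<bar>t\<bar> \<le> h" for s t
      using P [OF that(2,1)] by (simp add: ac_simps)
    let ?D = "f (A + h *\<^sub>R U + h *\<^sub>R V) - f (A + h *\<^sub>R U) - f (A + h *\<^sub>R V) + f A"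
    obtain s t where st: "0 < s" "s < h" "0 < t" "t < h" "?D = h * h * ?a (A + s *\<^sub>R U + t *\<^sub>R V)"
      using second_difference_mean_value [OF f U V h P] by blast
    obtain s' t' where st': "0 < s'" "s' < h" "0 < t'" "t' < h"
      "f (A + h *\<^sub>R V + h *\<^sub>R U) - f (A + h *\<^sub>R V) - f (A + h *\<^sub>R U) + f A
        = h * h * ?b (A + s' *\<^sub>R V + t' *\<^sub>R U)"
      using second_difference_mean_value [OF f V U h P'] by blast
    have comm: "A + x *\<^sub>R V + y *\<^sub>R U = A + y *\<^sub>R U + x *\<^sub>R V" for x y by simp
    have "?D = h * h * ?b (A + t' *\<^sub>R U + s' *\<^sub>R V)"
      using st'(5) unfolding comm by simp
    then have "?a (A + s *\<^sub>R U + t *\<^sub>R V) = ?b (A + t' *\<^sub>R U + s' *\<^sub>R V)"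
      using st(5) h by simp
    moreover have "\<bar>?a (A + s *\<^sub>R U + t *\<^sub>R V) - ?a A\<bar> < \<epsilon>"
      using st near [of s t] by (intro d1 P) (auto simp: r_def)
    moreover have "\<bar>?b (A + t' *\<^sub>R U + s' *\<^sub>R V) - ?b A\<bar> < \<epsilon>"
      using st' near [of t' s'] by (intro d2 P) (auto simp: r_def)
    ultimately show ?thesis by linarith
  qed
  \<comment> \<open>If the values differed, this choice of \<epsilon> would make their distance
    smaller than itself.\<close>
  from this [of "\<bar>?a A - ?b A\<bar> / 2"] show ?thesis by force
qed

lemma second_derivative_symmetric:
  fixes f :: "real^'n^'n \<Rightarrow> 'b::euclidean_space"
  assumes f: "C_class 2 f" and A: "A \<in> SPD" and U: "U \<in> Sym" and V: "V \<in> Sym"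
  shows "dir_deriv (\<lambda>B. dir_deriv f B U) A V = dir_deriv (\<lambda>B. dir_deriv f B V) A U"
proof (rule euclidean_eqI)
  fix b :: 'b assume "b \<in> Basis"
  note lin = bounded_linear_inner_left [of b]
  have "dir_deriv (\<lambda>B. dir_deriv (\<lambda>B. f B \<bullet> b) B U) A V = dir_deriv (\<lambda>B. dir_deriv f B U) A V \<bullet> b"
    if U: "U \<in> Sym" and V: "V \<in> Sym" for U V
  proof -
    have "dir_deriv (\<lambda>B. dir_deriv (\<lambda>B. f B \<bullet> b) B U) A V = dir_deriv (\<lambda>B. dir_deriv f B U \<bullet> b) A V"
      using f by (intro dir_deriv_cong A dir_deriv_linear_compose [OF _ U lin])
        (simp_all add: numeral_2_eq_2 differentiable_on_def)
    also have "\<dots> = dir_deriv (\<lambda>B. dir_deriv f B U) A V \<bullet> b"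
      using f U A by (intro dir_deriv_linear_compose [OF _ V lin])
        (simp_all add: numeral_2_eq_2 differentiable_on_def)
    finally show ?thesis .
  qed
  with second_derivative_symmetric_real [OF C_class_linear_compose [OF lin f] A U V] U V
  show "dir_deriv (\<lambda>B. dir_deriv f B U) A V \<bullet> b = dir_deriv (\<lambda>B. dir_deriv f B V) A U \<bullet> b"
    by simp
qed

text \<open>
  To differentiate, \<open>Y B\<close> is expanded in the constant fields that arise by symmetrizing the standard
  basis of all matrices.
\<close>

lemma dir_deriv_along_field:
  fixes Y Z :: "real^'n^'n \<Rightarrow> real^'n^'n"
  assumes Y: "vector_field Y" and Z: "vector_field Z" and A: "A \<in> SPD"
  shows "(\<lambda>B. dir_deriv Z B (Y B)) differentiable (at A within SPD)" (is ?diff)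
    and "V \<in> Sym \<Longrightarrow> dir_deriv (\<lambda>B. dir_deriv Z B (Y B)) A V
      = dir_deriv Z A (dir_deriv Y A V) + dir_deriv (\<lambda>B. dir_deriv Z B V) A (Y A)"
proof -
  \<comment> \<open>The projection onto \<open>Sym\<close>. It turns basis matrices into admissible
    directions of differentiation and fixes every symmetric matrix.\<close>
  define \<sigma> :: "real^'n^'n \<Rightarrow> real^'n^'n" where "\<sigma> b = (1/2) *\<^sub>R (b + transpose b)" for b
  have \<sigma>: "\<sigma> b \<in> Sym" for b
    by (simp add: \<sigma>_def Sym_def transpose_scalar transpose_add add.commute)
  have lin_\<sigma>: "linear \<sigma>"
    by (intro linearI) (simp_all add: \<sigma>_def transpose_add transpose_scalar algebra_simps)
  have expand: "(\<Sum>b\<in>Basis. (S \<bullet> b) *\<^sub>R \<sigma> b) = S" if "S \<in> Sym" for S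
  proof -
    have "(\<Sum>b\<in>Basis. (S \<bullet> b) *\<^sub>R \<sigma> b) = \<sigma> (\<Sum>b\<in>Basis. (S \<bullet> b) *\<^sub>R b)"
      using lin_\<sigma> by (simp add: linear_sum linear_scale)
    also have "\<dots> = S"
      using that by (simp add: euclidean_representation \<sigma>_def Sym_def scaleR_2 [symmetric])
    finally show ?thesis .
  qed
  have C2: "C_class 2 Z" and D_diff: "(\<lambda>B. dir_deriv Z B U) differentiable (at A within SPD)"
    if "U \<in> Sym" for U
  proof -
    show "C_class 2 Z" using Z by (simp add: vector_field_def smooth_def)
    then show "(\<lambda>B. dir_deriv Z B U) differentiable (at A within SPD)"
      using that A by (simp add: numeral_2_eq_2 differentiable_on_def)
  qed
  have lin_D: "linear (dir_deriv Z B)" if "B \<in> SPD" for B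
    using vector_field_has_derivative [OF Z that] by (rule has_derivative_linear)
  have lin_DD: "linear (dir_deriv (\<lambda>B. dir_deriv Z B U) A)" if "U \<in> Sym" for U
    using has_derivative_dir_deriv [OF D_diff [OF that]] by (rule has_derivative_linear)
  have apply_expand: "(\<Sum>b\<in>Basis. (S \<bullet> b) *\<^sub>R L (\<sigma> b)) = L S"
    if "S \<in> Sym" "linear L" for S and L :: "real^'n^'n \<Rightarrow> real^'n^'n"
  proof -
    have "L S = L (\<Sum>b\<in>Basis. (S \<bullet> b) *\<^sub>R \<sigma> b)" by (simp add: expand that)
    also have "\<dots> = (\<Sum>b\<in>Basis. (S \<bullet> b) *\<^sub>R L (\<sigma> b))"
      using \<open>linear L\<close> by (simp add: linear_sum linear_scale)
    finally show ?thesis by simp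
  qed
  define F where "F B = (\<Sum>b\<in>Basis. (Y B \<bullet> b) *\<^sub>R dir_deriv Z B (\<sigma> b))" for B
  have F: "dir_deriv Z B (Y B) = F B" if "B \<in> SPD" for B
    unfolding F_def using apply_expand [OF vector_field_Sym [OF Y that] lin_D [OF that]] by simp
  let ?F' = "\<lambda>W. \<Sum>b\<in>Basis. (Y A \<bullet> b) *\<^sub>R dir_deriv (\<lambda>B. dir_deriv Z B (\<sigma> b)) A W
      + (dir_deriv Y A W \<bullet> b) *\<^sub>R dir_deriv Z A (\<sigma> b)"
  have "(F has_derivative ?F') (at A within SPD)"
    unfolding F_def
    by (intro has_derivative_sum has_derivative_scaleR has_derivative_inner_left
        vector_field_has_derivative Y A has_derivative_dir_deriv D_diff \<sigma>)
  then have F': "((\<lambda>B. dir_deriv Z B (Y B)) has_derivative ?F') (at A within SPD)"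
    using has_derivative_SPD_cong [of A "\<lambda>B. dir_deriv Z B (Y B)" F] A F by simp
  then show ?diff by (auto simp: differentiable_def)
  assume V: "V \<in> Sym"
  have "dir_deriv (\<lambda>B. dir_deriv Z B (Y B)) A V = ?F' V"
    by (rule dir_deriv_eq [OF A V F'])
  \<comment> \<open>Symmetry of second derivatives moves \<open>\<sigma> b\<close> to the outer
    direction. The summands are then linear in it, so the sum recombines to the direction
    \<open>Y A\<close>.\<close>
  also have "\<dots> = (\<Sum>b\<in>Basis. (dir_deriv Y A V \<bullet> b) *\<^sub>R dir_deriv Z A (\<sigma> b))
      + (\<Sum>b\<in>Basis. (Y A \<bullet> b) *\<^sub>R dir_deriv (\<lambda>B. dir_deriv Z B V) A (\<sigma> b))"
    using second_derivative_symmetric [OF C2 [OF V] A \<sigma> V] by (simp add: sum.distrib add.commute)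
  also have "\<dots> = dir_deriv Z A (dir_deriv Y A V) + dir_deriv (\<lambda>B. dir_deriv Z B V) A (Y A)"
    using apply_expand [OF dir_deriv_Sym [OF Y A V] lin_D [OF A]]
      apply_expand [OF vector_field_Sym [OF Y A] lin_DD [OF V]] by simp
  finally show "dir_deriv (\<lambda>B. dir_deriv Z B (Y B)) A V
      = dir_deriv Z A (dir_deriv Y A V) + dir_deriv (\<lambda>B. dir_deriv Z B V) A (Y A)" .
qed

section \<open>Differentiating the solution of the Lyapunov equation\<close>

text \<open>Since one factor vanishes at \<open>A\<close>, continuity of the other suffices: the
  remainder is \<open>prod (B - A) (K B - K A)\<close>. This permits differentiating a product with
  \<open>Lyap\<close> before \<open>Lyap\<close> is known to be differentiable.\<close>

lemma has_derivative_bilinear_vanishing: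
  fixes prod :: "'a::real_normed_vector \<Rightarrow> 'b::real_normed_vector \<Rightarrow> 'c::real_normed_vector"
  assumes "bounded_bilinear prod" and K: "(K \<longlongrightarrow> K A) (at A within S)"
  shows "((\<lambda>B. prod (B - A) (K B)) has_derivative (\<lambda>V. prod V (K A))) (at A within S)"
proof -
  interpret bounded_bilinear prod by fact
  obtain M where M: "M > 0" "\<And>a b. norm (prod a b) \<le> norm a * norm b * M"
    using pos_bounded by blast
  have lim: "((\<lambda>B. norm (K B - K A) * M) \<longlongrightarrow> 0) (at A within S)"
    using K by (intro tendsto_mult_left_zero tendsto_norm_zero) (simp add: LIM_zero_iff)
  let ?q = "\<lambda>B. norm (prod (B - A) (K B) - prod (A - A) (K A) - prod (B - A) (K A)) / norm (B - A)"
  have "norm (?q B) \<le> norm (K B - K A) * M" for B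
  \<comment> \<open>At B = A the quotient is 0/0, which is 0.\<close>
  proof (cases "B = A")
    case False
    then show ?thesis
      using M(2) [of "B - A" "K B - K A"]
      by (simp add: diff_right [symmetric] zero_left divide_simps mult.commute mult.left_commute)
  qed simp
  then have "(?q \<longlongrightarrow> 0) (at A within S)"
    by (intro Lim_null_comparison [OF always_eventually lim] allI)
  then show ?thesis
    unfolding has_derivative_iff_norm using bounded_linear_left by blast
qed

text \<open>An analogue of the resolvent identity, obtained by subtracting the two Lyapunov
  equations. On the right the outer operator is \<open>Lyap A\<close> with \<open>A\<close> fixed,
  and the varying solution occurs only next to \<open>B - A\<close>.\<close>

lemma Lyap_difference:
  fixes A :: "real^'n^'n"
  assumes A: "A \<in> SPD" and B: "B \<in> SPD"
  shows "Lyap B Y' - Lyap A Y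
    = Lyap A (Y' - Y - (B - A) ** Lyap B Y' - Lyap B Y' ** (B - A))"
  using lyapunov_solution [OF A, of Y] lyapunov_solution [OF B, of Y']
  by (intro Lyap_eqI [OF A, symmetric]) (simp add: matrix_expand algebra_simps)

lemma bounded_linear_Lyap: "A \<in> SPD \<Longrightarrow> bounded_linear (Lyap A)"
  for A :: "real^'n^'n"
  by (simp add: linear_conv_bounded_linear [symmetric] linear_Lyap)

text \<open>With E = |K_B - K_A|, d = |B - A| and k = |K_A|, the difference identity gives E <= C
  (|Y_B - Y_A| + 2 M d (E + k)). Once 4 C M d < 1, the term with E on the right is at most E/2 and
  is absorbed; this is the origin of the factor 2 in \<open>?r\<close>.\<close>

lemma tendsto_Lyap:
  fixes A :: "real^'n^'n"
  assumes A: "A \<in> SPD" and Y: "(Y \<longlongrightarrow> Y A) (at A within SPD)"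
  shows "((\<lambda>B. Lyap B (Y B)) \<longlongrightarrow> Lyap A (Y A)) (at A within SPD)"
proof -
  let ?K = "\<lambda>B. Lyap B (Y B)" and ?F = "at A within SPD"
  obtain C where C: "C > 0" "\<And>W. norm (Lyap A W) \<le> norm W * C"
    using bounded_linear.pos_bounded [OF bounded_linear_Lyap [OF A]] by blast
  obtain M where M: "M > 0"
    "\<And>(P :: real^'n^'n) (Q :: real^'n^'n). norm (P ** Q) \<le> norm P * norm Q * M"
    using mm.pos_bounded by blast
  define k where "k = norm (?K A)"
  let ?r = "\<lambda>B. 2 * C * (norm (Y B - Y A) + 2 * M * k * norm (B - A))"
  have "((\<lambda>B. norm (B - A)) \<longlongrightarrow> norm (A - A)) ?F"
    by (intro tendsto_intros)
  then have BA: "((\<lambda>B. norm (B - A)) \<longlongrightarrow> 0) ?F"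
    by simp
  have "((\<lambda>B. norm (Y B - Y A)) \<longlongrightarrow> norm (Y A - Y A)) ?F"
    by (intro tendsto_intros Y)
  then have YA: "((\<lambda>B. norm (Y B - Y A)) \<longlongrightarrow> 0) ?F"
    by simp
  have "(?r \<longlongrightarrow> 2 * C * (0 + 2 * M * k * 0)) ?F"
    by (intro tendsto_intros BA YA)
  then have r: "(?r \<longlongrightarrow> 0) ?F" by simp
  have "((\<lambda>B. 4 * C * M * norm (B - A)) \<longlongrightarrow> 4 * C * M * 0) ?F"
    by (intro tendsto_intros BA)
  then have "\<forall>\<^sub>F B in ?F. 4 * C * M * norm (B - A) < 1"
    by (rule order_tendstoD) simp
  moreover have "\<forall>\<^sub>F B in ?F. B \<in> SPD"
    by (simp add: eventually_at_filter)
  ultimately have "\<forall>\<^sub>F B in ?F. norm (?K B - ?K A) \<le> ?r B"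
  proof eventually_elim
    case (elim B)
    let ?E = "norm (?K B - ?K A)" and ?d = "norm (B - A)"
    have KB: "norm (?K B) \<le> ?E + k"
      unfolding k_def using norm_triangle_ineq [of "?K B - ?K A" "?K A"] by simp
    have prods: "norm ((B - A) ** ?K B) \<le> ?d * (?E + k) * M" "norm (?K B ** (B - A)) \<le> ?d * (?E + k) * M"
    proof -
      have "?d * norm (?K B) * M \<le> ?d * (?E + k) * M"
        using KB M(1) by (intro mult_right_mono mult_left_mono) auto
      then show "norm ((B - A) ** ?K B) \<le> ?d * (?E + k) * M" "norm (?K B ** (B - A)) \<le> ?d * (?E + k) * M"
        using M(2) [of "B - A" "?K B"] M(2) [of "?K B" "B - A"] by (simp_all add: mult.commute)
    qed
    let ?W = "Y B - Y A - (B - A) ** ?K B - ?K B ** (B - A)"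
    have "norm ?W \<le> norm (Y B - Y A) + 2 * (?d * (?E + k) * M)"
      using prods norm_triangle_ineq4 [of "Y B - Y A - (B - A) ** ?K B" "?K B ** (B - A)"]
        norm_triangle_ineq4 [of "Y B - Y A" "(B - A) ** ?K B"] by linarith
    then have "norm ?W * C \<le> (norm (Y B - Y A) + 2 * (?d * (?E + k) * M)) * C"
      using C(1) by (intro mult_right_mono) auto
    moreover have "?E \<le> norm ?W * C"
      using C(2) [of ?W] by (simp only: Lyap_difference [OF A elim(2)])
    moreover have "4 * C * M * ?d * ?E \<le> 1 * ?E"
      using elim(1) by (intro mult_right_mono) auto
    ultimately show ?case by (simp add: algebra_simps)
  qed
  from Lim_null_comparison [OF this r] show ?thesis
    by (simp add: LIM_zero_iff)
qed

text \<open>In \<open>Lyap_difference\<close> each product has the factor \<open>B - A\<close>, so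
  continuity from \<open>tendsto_Lyap\<close> is enough to differentiate it, and the outer
  \<open>Lyap A\<close> is a fixed bounded linear map.\<close>

lemma has_derivative_Lyap:
  fixes A :: "real^'n^'n"
  assumes A: "A \<in> SPD" and Y: "(Y has_derivative Y') (at A within SPD)"
  shows "((\<lambda>B. Lyap B (Y B)) has_derivative
    (\<lambda>V. Lyap A (Y' V - V ** Lyap A (Y A) - Lyap A (Y A) ** V))) (at A within SPD)"
proof -
  let ?K = "\<lambda>B. Lyap B (Y B)"
  have "(Y \<longlongrightarrow> Y A) (at A within SPD)"
    using has_derivative_continuous [OF Y] by (simp add: continuous_within)
  then have K: "(?K \<longlongrightarrow> ?K A) (at A within SPD)"
    by (rule tendsto_Lyap [OF A])
  have "((\<lambda>B. Y B - Y A - (B - A) ** ?K B - ?K B ** (B - A)) has_derivative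
      (\<lambda>V. Y' V - 0 - V ** ?K A - ?K A ** V)) (at A within SPD)"
    by (intro has_derivative_diff Y has_derivative_const
        has_derivative_bilinear_vanishing [OF bounded_bilinear_matrix_matrix_mult, of ?K] K
        has_derivative_bilinear_vanishing [OF bounded_bilinear.flip [OF bounded_bilinear_matrix_matrix_mult], of ?K])
  then have "((\<lambda>B. ?K A + Lyap A (Y B - Y A - (B - A) ** ?K B - ?K B ** (B - A))) has_derivative
      (\<lambda>V. 0 + Lyap A (Y' V - 0 - V ** ?K A - ?K A ** V))) (at A within SPD)"
    by (intro has_derivative_add has_derivative_const
        bounded_linear.has_derivative [OF bounded_linear_Lyap [OF A]])
  then have D: "((\<lambda>B. ?K A + Lyap A (Y B - Y A - (B - A) ** ?K B - ?K B ** (B - A))) has_derivative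
      (\<lambda>V. Lyap A (Y' V - V ** ?K A - ?K A ** V))) (at A within SPD)"
    by simp
  show ?thesis
    by (rule has_derivative_SPD_cong [OF A, THEN iffD1, OF _ D])
      (simp add: Lyap_difference [OF A, symmetric])
qed

section \<open>The Levi-Civita connection\<close>

text \<open>The Christoffel term of the metric in the global linear chart \<open>Sym\<close>: what
  is added to the flat derivative to obtain the connection.\<close>

definition christoffel :: "real^'n^'n \<Rightarrow> real^'n^'n \<Rightarrow> real^'n^'n \<Rightarrow> real^'n^'n" where
  "christoffel A X Y = - (Lyap A X ** (A ** Lyap A Y) + Lyap A Y ** (A ** Lyap A X))"

lemma christoffel_commute: "christoffel A X Y = christoffel A Y X"
  by (simp add: christoffel_def add.commute)

lemma transpose_simps: "A \<in> SPD \<Longrightarrow> transpose A = A"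
  "A \<in> SPD \<Longrightarrow> X \<in> Sym \<Longrightarrow> transpose (Lyap A X) = Lyap A X"
  using Lyap_Sym [of A X] by (auto simp: SPD_def Sym_def)

lemma christoffel_Sym: "A \<in> SPD \<Longrightarrow> X \<in> Sym \<Longrightarrow> Y \<in> Sym \<Longrightarrow> christoffel A X Y \<in> Sym"
  by (simp add: christoffel_def Sym_def transpose_minus transpose_diff matrix_transpose_mul
      transpose_simps transpose_Lyap matrix_mul_assoc [symmetric])

lemma Lyap_add: "A \<in> SPD \<Longrightarrow> Lyap A (X + Y) = Lyap A X + Lyap A Y"
  and Lyap_diff: "A \<in> SPD \<Longrightarrow> Lyap A (X - Y) = Lyap A X - Lyap A Y"
  and Lyap_minus: "A \<in> SPD \<Longrightarrow> Lyap A (- X) = - Lyap A X"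
  using linear_Lyap [of A] by (simp_all add: linear_add linear_diff linear_neg)

lemma wasserstein_commute:
  assumes "A \<in> SPD" "X \<in> Sym" "Y \<in> Sym"
  shows "wasserstein A X Y = wasserstein A Y X"
proof -
  have "wasserstein A X Y = trace (X ** Lyap A Y) / 2"
    by (rule wasserstein_trace [OF assms])
  also have "\<dots> = trace (Y ** Lyap A X) / 2"
    by (metis trace_Lyap_left [OF assms(1)] trace_mul_sym)
  also have "\<dots> = wasserstein A Y X"
    by (rule wasserstein_trace [OF assms(1,3,2), symmetric])
  finally show ?thesis .
qed

lemma wasserstein_diff_left: "A \<in> SPD \<Longrightarrow> wasserstein A (X - Y) Z = wasserstein A X Z - wasserstein A Y Z"
  by (simp add: wasserstein_def Lyap_diff matrix_expand trace_sub)

lemma wasserstein_diff_right: "A \<in> SPD \<Longrightarrow> wasserstein A Z (X - Y) = wasserstein A Z X - wasserstein A Z Y"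
  by (simp add: wasserstein_def Lyap_diff matrix_expand trace_sub)

lemma wasserstein_eq_0:
  assumes A: "A \<in> SPD" and W: "W \<in> Sym" and "wasserstein A W W = 0"
  shows "W = 0"
proof -
  have "trace (transpose (Lyap A W) ** (A ** Lyap A W)) = 0"
    using assms by (simp add: wasserstein_def transpose_simps matrix_mul_assoc)
  then have "Lyap A W = 0"
    by (rule trace_congruence_eq_0 [OF A])
  then show ?thesis
    using lyapunov_solution [OF A, of W] by simp
qed

text \<open>Metric compatibility of the explicit connection. After differentiating tr(Y z)/2,
  self-adjointness moves \<open>Lyap A\<close> onto \<open>Y A\<close>; only the correction words
  remain to be matched.\<close>

lemma dir_deriv_wasserstein:
  fixes A :: "real^'n^'n"
  assumes A: "A \<in> SPD" and V: "V \<in> Sym" and Y: "vector_field Y" and Z: "vector_field Z"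
  shows "dir_deriv (\<lambda>B. wasserstein B (Y B) (Z B)) A V
    = wasserstein A (dir_deriv Y A V + christoffel A V (Y A)) (Z A)
      + wasserstein A (Y A) (dir_deriv Z A V + christoffel A V (Z A))"
proof -
  let ?y = "Lyap A (Y A)" and ?z = "Lyap A (Z A)" and ?v = "Lyap A V"
  let ?Y' = "dir_deriv Y A" and ?Z' = "dir_deriv Z A"
  note S = vector_field_Sym [OF Y A] vector_field_Sym [OF Z A] dir_deriv_Sym [OF Y A V]
    dir_deriv_Sym [OF Z A V] Sym_add christoffel_Sym [OF A]
  let ?D = "\<lambda>V. trace (Y A ** Lyap A (?Z' V - V ** ?z - ?z ** V) + ?Y' V ** ?z) / 2"
  have "bounded_linear (\<lambda>M :: real^'n^'n. trace M / 2)"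
    by (rule bounded_linear_compose [OF bounded_linear_divide bounded_linear_trace])
  from bounded_linear.has_derivative [OF this mm.FDERIV
      [OF vector_field_has_derivative [OF Y A]
        has_derivative_Lyap [OF A vector_field_has_derivative [OF Z A]]]]
  have "((\<lambda>B. trace (Y B ** Lyap B (Z B)) / 2) has_derivative ?D) (at A within SPD)" .
  then have D: "((\<lambda>B. wasserstein B (Y B) (Z B)) has_derivative ?D) (at A within SPD)"
    by (rule has_derivative_SPD_cong [OF A, THEN iffD1, rotated])
      (simp add: wasserstein_trace vector_field_Sym Y Z)
  have "dir_deriv (\<lambda>B. wasserstein B (Y B) (Z B)) A V = ?D V"
    by (rule dir_deriv_eq [OF A V D])
  also have "\<dots> = (trace (?y ** (?Z' V - V ** ?z - ?z ** V)) + trace (?Y' V ** ?z)) / 2"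
    by (simp add: trace_add trace_Lyap_left [OF A])
  also have "\<dots> = (trace ((?Y' V + christoffel A V (Y A)) ** ?z) + trace (?y ** (?Z' V + christoffel A V (Z A)))) / 2"
  proof -
    \<comment> \<open>Inserting V = Av + vA yields four words, which up to rotation are exactly
      those of the two Christoffel terms.\<close>
    have "trace (?y ** (V ** ?z + ?z ** V)) = trace (?y ** ((A ** ?v + ?v ** A) ** ?z + ?z ** (A ** ?v + ?v ** A)))"
      by (simp add: lyapunov_solution [OF A])
    also have "\<dots> = trace (?y ** (A ** (?v ** ?z))) + trace (?y ** (?v ** (A ** ?z)))
        + trace (?y ** (?z ** (A ** ?v))) + trace (?y ** (?z ** (?v ** A)))"
      by (simp add: matrix_expand trace_add)
    also have "trace (?y ** (?z ** (?v ** A))) = trace (?v ** (A ** (?y ** ?z)))"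
      by (metis matrix_mul_assoc trace_cyclic)
    finally show ?thesis
      by (simp add: christoffel_def matrix_expand trace_add trace_sub trace_minus)
  qed
  also have "\<dots> = wasserstein A (?Y' V + christoffel A V (Y A)) (Z A)
      + wasserstein A (Y A) (?Z' V + christoffel A V (Z A))"
    by (simp add: wasserstein_trace A S V trace_Lyap_left)
  finally show ?thesis .
qed

lemma levi_civita_wasserstein:
  fixes A :: "real^'n^'n"
  assumes nabla: "levi_civita wasserstein nabla"
    and A: "A \<in> SPD" and X: "vector_field X" and Y: "vector_field Y"
  shows "nabla X Y A = dir_deriv Y A (X A) + christoffel A (X A) (Y A)"
proof -
  define D where "D X Y = nabla X Y A - (dir_deriv Y A (X A) + christoffel A (X A) (Y A))"
    for X Y :: "real^'n^'n \<Rightarrow> real^'n^'n"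
  have vf: "vector_field (nabla X Y)" if "vector_field X" "vector_field Y" for X Y
    using nabla that by (simp add: levi_civita_def affine_connection_def)
  have Sym: "D X Y \<in> Sym" if "vector_field X" "vector_field Y" for X Y
    unfolding D_def using that A
    by (intro Sym_diff Sym_add christoffel_Sym dir_deriv_Sym vector_field_Sym vf)
  have sym: "D X Y = D Y X" if "vector_field X" "vector_field Y" for X Y
  proof -
    have "nabla X Y A - nabla Y X A = dir_deriv Y A (X A) - dir_deriv X A (Y A)"
      using nabla that A by (simp add: levi_civita_def torsion_free_def lie_bracket_def)
    then show ?thesis
      by (simp add: D_def christoffel_commute [of A "X A"] algebra_simps)
  qed
  have antisym: "wasserstein A (D X Y) (Z A) = - wasserstein A (D X Z) (Y A)"
    if "vector_field X" "vector_field Y" "vector_field Z" for X Y Z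
  proof -
    have "dir_deriv (\<lambda>B. wasserstein B (Y B) (Z B)) A (X A)
        = wasserstein A (nabla X Y A) (Z A) + wasserstein A (Y A) (nabla X Z A)"
      using nabla that A by (simp add: levi_civita_def metric_compatible_def)
    then have "wasserstein A (D X Y) (Z A) + wasserstein A (Y A) (D X Z) = 0"
      using dir_deriv_wasserstein [OF A vector_field_Sym [OF that(1) A] that(2,3)]
      by (simp add: D_def wasserstein_diff_left wasserstein_diff_right A)
    then show ?thesis
      using wasserstein_commute [OF A vector_field_Sym [OF that(2) A] Sym [OF that(1,3)]] by simp
  qed
  define W where "W = D X Y"
  have W: "W \<in> Sym" unfolding W_def by (rule Sym [OF X Y])
  \<comment> \<open>The test field is constant with the value of the difference at \<open>A\<close>,
    so the pairing to be shown zero is the squared norm of \<open>W\<close>.\<close>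
  define Z where "Z = (\<lambda>B :: real^'n^'n. W)"
  have Z: "vector_field Z" unfolding Z_def by (rule vector_field_const [OF W])
  \<comment> \<open>Alternating the two symmetries around the six permutations of the fields returns
    to the starting term with the opposite sign.\<close>
  have "wasserstein A (D X Z) (Y A) = - wasserstein A (D Z Y) (X A)"
    using antisym [OF Z X Y] by (simp only: sym [OF X Z])
  moreover have "wasserstein A (D Z Y) (X A) = - wasserstein A (D X Y) (Z A)"
    using antisym [OF Y Z X] by (simp only: sym [OF Z Y] sym [OF X Y])
  ultimately have "wasserstein A (D X Y) (Z A) = 0"
    using antisym [OF X Y Z] by linarith
  then have "W = 0"
    by (intro wasserstein_eq_0 [OF A W]) (simp add: W_def Z_def)
  then show ?thesis by (simp add: W_def D_def)
qed

section \<open>Curvature\<close>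

text \<open>The product rule for words such as yAz. Differentiating \<open>y\<close> and
  \<open>z\<close> yields Christoffel terms, in which the corrections Vy + yV and Vz + zV come from
  the moving base point of \<open>Lyap\<close>; differentiating the middle \<open>A\<close> yields
  the last bracket.\<close>

lemma dir_deriv_christoffel:
  fixes A :: "real^'n^'n"
  assumes A: "A \<in> SPD" and Y: "vector_field Y" and Z: "vector_field Z"
  defines "y \<equiv> Lyap A (Y A)" and "z \<equiv> Lyap A (Z A)"
  shows "(\<lambda>B. christoffel B (Y B) (Z B)) differentiable (at A within SPD)" (is ?diff)
    and "V \<in> Sym \<Longrightarrow> dir_deriv (\<lambda>B. christoffel B (Y B) (Z B)) A V
      = christoffel A (dir_deriv Y A V) (Z A) + christoffel A (Y A) (dir_deriv Z A V)
        - christoffel A (V ** y + y ** V) (Z A) - christoffel A (Y A) (V ** z + z ** V)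
        - (y ** (V ** z) + z ** (V ** y))"
proof -
  define y' where "y' V = Lyap A (dir_deriv Y A V - V ** y - y ** V)" for V
  define z' where "z' V = Lyap A (dir_deriv Z A V - V ** z - z ** V)" for V
  have y: "((\<lambda>B. Lyap B (Y B)) has_derivative y') (at A within SPD)"
    unfolding y'_def y_def by (rule has_derivative_Lyap [OF A vector_field_has_derivative [OF Y A]])
  have z: "((\<lambda>B. Lyap B (Z B)) has_derivative z') (at A within SPD)"
    unfolding z'_def z_def by (rule has_derivative_Lyap [OF A vector_field_has_derivative [OF Z A]])
  let ?D = "\<lambda>V. - ((y ** (A ** z' V + V ** z) + y' V ** (A ** z))
      + (z ** (A ** y' V + V ** y) + z' V ** (A ** y)))"
  have D: "((\<lambda>B. christoffel B (Y B) (Z B)) has_derivative ?D) (at A within SPD)"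
    unfolding christoffel_def y_def z_def
    by (intro has_derivative_minus has_derivative_add mm.FDERIV has_derivative_ident
        y [unfolded y_def] z [unfolded z_def])
  then show ?diff by (auto simp: differentiable_def)
  assume V: "V \<in> Sym"
  have "dir_deriv (\<lambda>B. christoffel B (Y B) (Z B)) A V = ?D V"
    by (rule dir_deriv_eq [OF A V D])
  also have "\<dots> = christoffel A (dir_deriv Y A V) (Z A) + christoffel A (Y A) (dir_deriv Z A V)
        - christoffel A (V ** y + y ** V) (Z A) - christoffel A (Y A) (V ** z + z ** V)
        - (y ** (V ** z) + z ** (V ** y))"
    unfolding christoffel_def y'_def z'_def
    by (simp add: Lyap_diff Lyap_add A y_def [symmetric] z_def [symmetric] matrix_expand algebra_simps)
  finally show "dir_deriv (\<lambda>B. christoffel B (Y B) (Z B)) A V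
      = christoffel A (dir_deriv Y A V) (Z A) + christoffel A (Y A) (dir_deriv Z A V)
        - christoffel A (V ** y + y ** V) (Z A) - christoffel A (Y A) (V ** z + z ** V)
        - (y ** (V ** z) + z ** (V ** y))" .
qed

lemma christoffel_bilinear:
  assumes "A \<in> SPD"
  shows "christoffel A (X + X') Y = christoffel A X Y + christoffel A X' Y"
    and "christoffel A (X - X') Y = christoffel A X Y - christoffel A X' Y"
    and "christoffel A Y (X + X') = christoffel A Y X + christoffel A Y X'"
    and "christoffel A Y (X - X') = christoffel A Y X - christoffel A Y X'"
  using assms by (simp_all add: christoffel_def Lyap_add Lyap_diff matrix_expand)

lemma vector_field_nabla:
  "levi_civita g nabla \<Longrightarrow> vector_field X \<Longrightarrow> vector_field Y \<Longrightarrow> vector_field (nabla X Y)"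
  by (simp add: levi_civita_def affine_connection_def)

text \<open>Smoothness of the bracket is read off from torsion-freeness: on \<open>SPD\<close> it is
  a difference of two covariant derivatives, which are vector fields by assumption on the
  connection.\<close>

lemma vector_field_lie_bracket:
  fixes nabla :: "(real^'n^'n \<Rightarrow> real^'n^'n) \<Rightarrow> _" and X Y :: "real^'n^'n \<Rightarrow> real^'n^'n"
  assumes nabla: "levi_civita g nabla" and X: "vector_field X" and Y: "vector_field Y"
  shows "vector_field (lie_bracket X Y)"
proof -
  have "vector_field (\<lambda>B. nabla X Y B - nabla Y X B)"
    by (intro vector_field_diff vector_field_nabla [OF nabla] X Y)
  moreover have "nabla X Y B - nabla Y X B = lie_bracket X Y B" if "B \<in> SPD" for B
    using nabla X Y that by (simp add: levi_civita_def torsion_free_def)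
  ultimately show ?thesis
    by (rule vector_field_cong [THEN iffD1, rotated])
qed

text \<open>The second derivative of \<open>Z\<close> appears with frozen directions
  \<open>X A\<close> and \<open>Y A\<close>, ready to cancel against its counterpart with
  \<open>X\<close> and \<open>Y\<close> exchanged.\<close>

lemma nabla_nabla:
  fixes A :: "real^'n^'n"
  assumes nabla: "levi_civita wasserstein nabla"
    and A: "A \<in> SPD" and X: "vector_field X" and Y: "vector_field Y" and Z: "vector_field Z"
  defines "y \<equiv> Lyap A (Y A)" and "z \<equiv> Lyap A (Z A)"
  shows "nabla X (nabla Y Z) A
    = dir_deriv Z A (dir_deriv Y A (X A)) + dir_deriv (\<lambda>B. dir_deriv Z B (X A)) A (Y A)
      + christoffel A (dir_deriv Y A (X A)) (Z A) + christoffel A (Y A) (dir_deriv Z A (X A))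
      + christoffel A (X A) (dir_deriv Z A (Y A)) + christoffel A (X A) (christoffel A (Y A) (Z A))
      - christoffel A (X A ** y + y ** X A) (Z A) - christoffel A (Y A) (X A ** z + z ** X A)
      - (y ** (X A ** z) + z ** (X A ** y))"
proof -
  note YZ = vector_field_nabla [OF nabla Y Z]
  have eq: "nabla Y Z B = dir_deriv Z B (Y B) + christoffel B (Y B) (Z B)" if "B \<in> SPD" for B
    by (rule levi_civita_wasserstein [OF nabla that Y Z])
  have XA: "X A \<in> Sym" by (rule vector_field_Sym [OF X A])
  have "dir_deriv (nabla Y Z) A (X A)
      = dir_deriv (\<lambda>B. dir_deriv Z B (Y B) + christoffel B (Y B) (Z B)) A (X A)"
    by (rule dir_deriv_cong [OF A eq])
  also have "\<dots> = dir_deriv (\<lambda>B. dir_deriv Z B (Y B)) A (X A)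
      + dir_deriv (\<lambda>B. christoffel B (Y B) (Z B)) A (X A)"
    by (rule dir_deriv_add [OF A XA dir_deriv_along_field(1) [OF Y Z A] dir_deriv_christoffel(1) [OF A Y Z]])
  finally show ?thesis
    unfolding levi_civita_wasserstein [OF nabla A X YZ] eq [OF A]
    using dir_deriv_along_field(2) [OF Y Z A XA] dir_deriv_christoffel(2) [OF A Y Z XA]
    by (simp add: christoffel_bilinear [OF A] y_def z_def algebra_simps)
qed

text \<open>The bracket term absorbs the derivatives of \<open>X\<close> and \<open>Y\<close>, the
  first derivatives of \<open>Z\<close> cancel in pairs, and its second derivatives cancel by
  symmetry. Only the values of the fields at \<open>A\<close> remain.\<close>

lemma curvature_christoffel:
  fixes A :: "real^'n^'n"
  assumes nabla: "levi_civita wasserstein nabla"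
    and A: "A \<in> SPD" and X: "vector_field X" and Y: "vector_field Y" and Z: "vector_field Z"
  defines "x \<equiv> Lyap A (X A)" and "y \<equiv> Lyap A (Y A)" and "z \<equiv> Lyap A (Z A)"
  shows "curvature nabla X Y Z A
    = christoffel A (X A ** y + y ** X A) (Z A) + christoffel A (Y A) (X A ** z + z ** X A)
      + (y ** (X A ** z) + z ** (X A ** y)) - christoffel A (X A) (christoffel A (Y A) (Z A))
      - christoffel A (Y A ** x + x ** Y A) (Z A) - christoffel A (X A) (Y A ** z + z ** Y A)
      - (x ** (Y A ** z) + z ** (Y A ** x)) + christoffel A (Y A) (christoffel A (X A) (Z A))"
proof -
  note XY = vector_field_lie_bracket [OF nabla X Y]
  have "linear (dir_deriv Z A)"
    using vector_field_has_derivative [OF Z A] by (rule has_derivative_linear)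
  then have bracket: "dir_deriv Z A (lie_bracket X Y A)
      = dir_deriv Z A (dir_deriv Y A (X A)) - dir_deriv Z A (dir_deriv X A (Y A))"
    by (simp add: lie_bracket_def linear_diff)
  have "C_class 2 Z" using Z by (simp add: vector_field_def smooth_def)
  then have sym: "dir_deriv (\<lambda>B. dir_deriv Z B (X A)) A (Y A) = dir_deriv (\<lambda>B. dir_deriv Z B (Y A)) A (X A)"
    by (rule second_derivative_symmetric [OF _ A vector_field_Sym [OF X A] vector_field_Sym [OF Y A]])
  show ?thesis
    unfolding curvature_def nabla_nabla [OF nabla A X Y Z] nabla_nabla [OF nabla A Y X Z]
      levi_civita_wasserstein [OF nabla A XY Z] bracket sym
    by (simp add: lie_bracket_def christoffel_bilinear [OF A] x_def y_def z_def algebra_simps)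
qed

section \<open>Traces of words of length five\<close>

lemma trace_rotate5:
  fixes P Q R S T :: "real^'n^'n"
  shows "trace (P ** (Q ** (R ** (S ** T)))) = trace (Q ** (R ** (S ** (T ** P))))"
  using trace_mul_sym [of P "Q ** (R ** (S ** T))"] by (simp add: matrix_mul_assoc [symmetric])

lemma trace_reverse5:
  fixes P Q R S T :: "real^'n^'n"
  shows "trace (P ** (Q ** (R ** (S ** T)))) =
    trace (transpose T ** (transpose S ** (transpose R ** (transpose Q ** transpose P))))"
  by (subst trace_transpose [symmetric]) (simp add: matrix_transpose_mul matrix_mul_assoc [symmetric])

text \<open>The left side is twice the trace of the curvature against \<open>y\<close> once
  \<open>e\<close> and \<open>f\<close> of the main proof have cancelled. Rotation and reversal
  identify many words, reversal flipping the sign when \<open>K\<close> occurs. Up to rotation two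
  words with \<open>K\<close> survive, AAKyx and AKAyx, and the equation for \<open>K\<close>
  eliminates the first.\<close>

lemma commutator_trace_identity:
  fixes A K x y :: "real^'n^'n"
  assumes sym: "transpose A = A" "transpose x = x" "transpose y = y" and K: "transpose K = - K"
    and comm: "A ** K + K ** A = x ** y - y ** x"
  shows "trace ((x ** y + y ** x) ** (A ** x ** y + y ** x ** A))
      - 3 * trace ((A ** K - K ** A) ** (A ** x ** y + y ** x ** A))
      - 2 * trace (x ** x ** (A ** y ** y + y ** y ** A))
      + 2 * trace (y ** (A ** x + x ** A) ** x ** y) + 2 * trace (x ** (A ** x + x ** A) ** y ** y)
      - 4 * trace (x ** (A ** y + y ** A) ** x ** y)
    = 12 * trace (x ** A ** K ** A ** y)"
proof -
  \<comment> \<open>A general rotation rule would loop in the simplifier. These instances send the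
    rotations of a word that occur to one representative.\<close>
  note rotations =
    trace_rotate5 [of y x A y x]
    trace_rotate5 [of x A y x y]
    trace_rotate5 [of x y y x A]
    trace_rotate5 [of y y x A x]
    trace_rotate5 [of y x A x y]
    trace_rotate5 [of x A x y y]
    trace_rotate5 [of y x y x A]
    trace_rotate5 [of x y x A y]
    trace_rotate5 [of y y A x x]
    trace_rotate5 [of y A x x y]
    trace_rotate5 [of x x y y A]
    trace_rotate5 [of x y y A x]
    trace_rotate5 [of y x A K A]
    trace_rotate5 [of x A K A y]
    trace_rotate5 [of A K A y x]
    trace_rotate5 [of A K y x A]
    trace_rotate5 [of y x A A K]
    trace_rotate5 [of x A A K y]
    trace_rotate5 [of A A K y x]
  note reversals =
    trace_reverse5 [of x y A x y]
    trace_reverse5 [of x x A y y]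
    trace_reverse5 [of A K A x y]
    trace_reverse5 [of K A A x y]
  \<comment> \<open>The relation that trades AAKyx for AKAyx; it doubles the coefficient 6 of the
    latter to 12.\<close>
  have "trace (A ** (A ** K + K ** A) ** (y ** x)) = trace (A ** (x ** y - y ** x) ** (y ** x))"
    by (simp only: comm)
  then show ?thesis
    by (simp add: matrix_expand trace_add trace_sub trace_minus rotations reversals [unfolded sym K])
qed

theorem theorem6p1:
  fixes A :: "real^'n^'n"
    and X Y :: "real^'n^'n \<Rightarrow> real^'n^'n"
    and nabla :: "(real^'n^'n \<Rightarrow> real^'n^'n) \<Rightarrow> (real^'n^'n \<Rightarrow> real^'n^'n) \<Rightarrow> real^'n^'n \<Rightarrow> real^'n^'n"
  assumes "levi_civita wasserstein nabla"
    and "A \<in> SPD"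
    and "vector_field X" and "vector_field Y"
  shows "wasserstein A (curvature nabla X Y X A) (Y A) =
    3 * trace (Lyap A (X A) ** A
      ** Lyap A (Lyap A (X A) ** Lyap A (Y A) - Lyap A (Y A) ** Lyap A (X A))
      ** A ** Lyap A (Y A))"
proof -
  note A = \<open>A \<in> SPD\<close> and X = \<open>vector_field X\<close> and Y = \<open>vector_field Y\<close>
  define x where "x = Lyap A (X A)"
  define y where "y = Lyap A (Y A)"
  define K where "K = Lyap A (x ** y - y ** x)"
  \<comment> \<open>Up to sign, and a factor 2 for \<open>f\<close>, \<open>e\<close> and
    \<open>f\<close> are \<open>Lyap A\<close> of the inner Christoffel terms; \<open>p\<close>,
    \<open>q\<close> and \<open>r\<close> are \<open>Lyap A\<close> of the correction terms in
    \<open>curvature_christoffel\<close>.\<close>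
  define e where "e = Lyap A (x ** (A ** y) + y ** (A ** x))"
  define f where "f = Lyap A (x ** (A ** x))"
  define p where "p = Lyap A (X A ** y + y ** X A)"
  define q where "q = Lyap A (Y A ** x + x ** Y A)"
  define r where "r = Lyap A (X A ** x + x ** X A)"
  define R where "R = curvature nabla X Y X A"
  have XA: "X A = A ** x + x ** A" and YA: "Y A = A ** y + y ** A"
    unfolding x_def y_def by (simp_all add: lyapunov_solution [OF A])
  have sym: "transpose A = A" "transpose x = x" "transpose y = y"
    unfolding x_def y_def by (simp_all add: transpose_simps A vector_field_Sym X Y)
  have K_anti: "transpose K = - K"
    unfolding K_def transpose_Lyap [OF A]
    by (simp add: transpose_diff matrix_transpose_mul sym Lyap_minus [OF A, symmetric])
  have K: "A ** K + K ** A = x ** y - y ** x"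
    unfolding K_def by (rule lyapunov_solution [OF A])
  \<comment> \<open>The equations for \<open>K\<close>, \<open>e\<close> and \<open>f\<close> are
    oriented as rewrite rules that move \<open>A\<close> to the right. The version with
    \<open>W\<close> applies inside right-nested products.\<close>
  have "A ** K = x ** y - y ** x - K ** A"
    using K by (simp add: eq_diff_eq)
  moreover from this have "A ** (K ** W) = x ** (y ** W) - y ** (x ** W) - K ** (A ** W)"
    for W :: "real^'n^'n"
    by (simp add: matrix_mul_assoc mm.diff_left)
  ultimately have AK: "A ** K = x ** y - y ** x - K ** A"
    "\<And>W :: real^'n^'n. A ** (K ** W) = x ** (y ** W) - y ** (x ** W) - K ** (A ** W)"
    by blast+
  have "A ** e + e ** A = x ** (A ** y) + y ** (A ** x)"
    unfolding e_def by (rule lyapunov_solution [OF A])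
  then have Ae: "A ** e = x ** (A ** y) + y ** (A ** x) - e ** A"
    by (simp add: eq_diff_eq)
  have "A ** f + f ** A = x ** (A ** x)"
    unfolding f_def by (rule lyapunov_solution [OF A])
  then have Af: "A ** f = x ** (A ** x) - f ** A"
    by (simp add: eq_diff_eq)
  \<comment> \<open>\<open>A ** K - K ** A\<close> is \<open>Lyap A (A ** k - k ** A)\<close> for the commutator \<open>k = x ** y - y ** x\<close>;
    the terms \<open>e\<close> and \<open>f\<close> cancel in the curvature.\<close>
  have p: "p + p = x ** y + y ** x + (A ** K - K ** A) + e + e"
    unfolding p_def Lyap_add [OF A, symmetric] XA
    by (rule Lyap_eqI [OF A]) (simp only: matrix_expand AK Ae, simp add: algebra_simps)
  \<comment> \<open>Exchanging \<open>x\<close> and \<open>y\<close> in the formula for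
    \<open>p\<close> fixes \<open>e\<close> and changes the sign of \<open>K\<close>. The formula
    for \<open>r\<close> below corresponds to equal arguments, where the commutator
    vanishes.\<close>
  have q: "q + q = x ** y + y ** x - (A ** K - K ** A) + e + e"
    unfolding q_def Lyap_add [OF A, symmetric] YA
    by (rule Lyap_eqI [OF A]) (simp only: matrix_expand AK Ae, simp add: algebra_simps)
  have r: "r = x ** x + f + f"
    unfolding r_def XA
    by (rule Lyap_eqI [OF A]) (simp only: matrix_expand Af, simp add: algebra_simps)
  have "Lyap A (christoffel A (Y A) (X A)) = - e"
    unfolding christoffel_def x_def [symmetric] y_def [symmetric] Lyap_minus [OF A] e_def
    by (simp add: add.commute)
  then have c1: "christoffel A (X A) (christoffel A (Y A) (X A)) = e ** (A ** x) + x ** (A ** e)"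
    by (simp add: christoffel_def [of A "X A" "christoffel A (Y A) (X A)"] x_def [symmetric]
        matrix_expand)
  have "Lyap A (christoffel A (X A) (X A)) = - (f + f)"
    unfolding christoffel_def x_def [symmetric] Lyap_minus [OF A] f_def Lyap_add [OF A] ..
  then have c2: "christoffel A (Y A) (christoffel A (X A) (X A))
      = (f ** (A ** y) + y ** (A ** f)) + (f ** (A ** y) + y ** (A ** f))"
    unfolding christoffel_def [of A "Y A" "christoffel A (X A) (X A)"] y_def [symmetric]
    by (simp only: matrix_expand, simp add: algebra_simps)
  have cp: "christoffel A (X A ** y + y ** X A) (X A) = - (p ** (A ** x) + x ** (A ** p))"
    by (simp add: christoffel_def p_def x_def)
  have cq: "christoffel A (Y A ** x + x ** Y A) (X A) = - (q ** (A ** x) + x ** (A ** q))"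
    by (simp add: christoffel_def q_def x_def)
  have cq': "christoffel A (X A) (Y A ** x + x ** Y A) = - (q ** (A ** x) + x ** (A ** q))"
    unfolding christoffel_commute [of A "X A"] by (rule cq)
  have cr: "christoffel A (Y A) (X A ** x + x ** X A) = - (r ** (A ** y) + y ** (A ** r))"
    by (simp add: christoffel_def r_def y_def add.commute)
  let ?u = "A ** x ** y + y ** x ** A" and ?v = "A ** y ** y + y ** y ** A"
  \<comment> \<open>Cyclicity brings the unknown factor \<open>M\<close> to the front, so that each
    Christoffel term becomes a pairing with the fixed matrix \<open>?u\<close> or
    \<open>?v\<close>.\<close>
  have u: "trace ((M ** (A ** x) + x ** (A ** M)) ** y) = trace (M ** ?u)" for M
    using trace_cyclic [of x "A ** M" y] trace_cyclic [of A M "y ** x"]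
    by (simp add: matrix_expand trace_add)
  have v: "trace ((M ** (A ** y) + y ** (A ** M)) ** y) = trace (M ** ?v)" for M
    using trace_cyclic [of y "A ** M" y] trace_cyclic [of A M "y ** y"]
    by (simp add: matrix_expand trace_add)
  have R: "R = - (p ** (A ** x) + x ** (A ** p)) - (r ** (A ** y) + y ** (A ** r))
      + y ** X A ** x + x ** X A ** y - (e ** (A ** x) + x ** (A ** e))
      + (q ** (A ** x) + x ** (A ** q)) + (q ** (A ** x) + x ** (A ** q))
      - x ** Y A ** x - x ** Y A ** x
      + (f ** (A ** y) + y ** (A ** f)) + (f ** (A ** y) + y ** (A ** f))"
    unfolding R_def curvature_christoffel [OF assms(1) A X Y X]
      x_def [symmetric] y_def [symmetric] c1 c2 cp cq cq' cr
    by (simp add: matrix_mul_assoc [symmetric] algebra_simps)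
  have "trace (R ** y) = - trace (p ** ?u) - trace (r ** ?v)
      + trace (y ** X A ** x ** y) + trace (x ** X A ** y ** y) - trace (e ** ?u)
      + 2 * trace (q ** ?u) - 2 * trace (x ** Y A ** x ** y) + 2 * trace (f ** ?v)"
    unfolding u [symmetric] v [symmetric] R
    by (simp only: mm.add_left mm.diff_left mm.minus_left trace_add trace_sub trace_minus mult_2
        diff_conv_add_uminus minus_add_distrib ac_simps)
  moreover have "trace ((p + p) ** ?u) = 2 * trace (p ** ?u)" "trace ((q + q) ** ?u) = 2 * trace (q ** ?u)"
    by (simp_all only: mm.add_left trace_add mult_2)
  then have "2 * trace (p ** ?u) = trace ((x ** y + y ** x) ** ?u) + trace ((A ** K - K ** A) ** ?u) + 2 * trace (e ** ?u)"
    "2 * trace (q ** ?u) = trace ((x ** y + y ** x) ** ?u) - trace ((A ** K - K ** A) ** ?u) + 2 * trace (e ** ?u)"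
    unfolding p q mm.add_left [of _ _ ?u] mm.diff_left [of _ _ ?u] trace_add trace_sub by linarith+
  moreover have "trace (r ** ?v) = trace (x ** x ** ?v) + 2 * trace (f ** ?v)"
    unfolding r by (simp only: mm.add_left [of _ _ ?v] trace_add mult_2 add.assoc)
  \<comment> \<open>The coefficients of tr(e u) are -1, -1 and 2, and those of tr(f v) are -2 and 2,
    so both cancel. The metric contributes another factor 1/2, which turns 12 into 3.\<close>
  ultimately have "2 * trace (R ** y) = 12 * trace (x ** A ** K ** A ** y)"
    using commutator_trace_identity [OF sym K_anti K] unfolding XA YA by linarith
  \<comment> \<open>Symmetry of \<open>R\<close> allows the metric to be evaluated by
    \<open>wasserstein_trace\<close>.\<close>
  moreover have RA: "R \<in> Sym"
    unfolding R_def curvature_def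
    by (intro Sym_add Sym_diff vector_field_Sym [OF _ A] vector_field_nabla [OF assms(1)]
        vector_field_lie_bracket [OF assms(1)] X Y)
  ultimately show ?thesis
    using wasserstein_trace [OF A RA[unfolded R_def] vector_field_Sym [OF Y A]]
    by (simp add: R_def x_def y_def K_def)
qed

end
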